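(* Let $X$ be a compact metric space, $Y=\{1,\dots,d\}^{\mathbb{N}}$ with shift $\sigma$, $\mu$ a Borel probability measure on $X$, and $c:X\times Y\to\mathbb{R}$ a continuous function. For each $\nu\in\mathrm{Fix}_n$ let $\pi(\mu,\nu)$ be any chosen maximizing plan from $\mu$ to $\nu$ for $c$, and for $\beta>0$ and $n\ge1$ let $\zeta_{\beta,n}$ be the probability measure on $X\times Y$ given by $$\zeta_{\beta,n}(w)=\frac{\sum_{\nu\in\mathrm{Fix}_n}e^{\beta n\int c\,d\pi(\mu,\nu)}\int w\,d\pi(\mu,\nu)}{\sum_{\nu\in\mathrm{Fix}_n}e^{\beta n\int c\,d\pi(\mu,\nu)}},\qquad w\in C(X\times Y).$$ If $\beta_j\to\infty$, $n_j\to\infty$ and $\zeta_{\beta_j,n_j}\to\pi_\infty$ in the weak* topology, then $\pi_\infty\in\Pi(\mu,\sigma)$. Moreover, if $c>0$ on $X\times Y$, then $\pi_\infty$ maximizes the integral of $c$ among the measures in $\Pi(\mu,\sigma)$, i.e. $\int c\,d\pi_\infty=\sup_{\pi\in\Pi(\mu,\sigma)}\int c\,d\pi$.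
   Context: The shift is $\sigma(y_0,y_1,y_2,\dots)=(y_1,y_2,\dots)$ on $Y$. $C(X\times Y)$ is the set of continuous real-valued functions on $X\times Y$. $\mathrm{Fix}_n$ is the (finite) set of $\sigma$-invariant probability measures on $Y$ supported on a periodic orbit of length $n$, i.e. the measures $\frac1n\sum_{i=0}^{n-1}\delta_{\sigma^i(y)}$ with $\sigma^n(y)=y$. A maximizing plan from $\mu$ to $\nu$ for $c$ is a Borel probability measure on $X\times Y$ with $X$-marginal $\mu$ and $Y$-marginal $\nu$ that maximizes $\int c\,d\pi$ among all Borel probability measures $\pi$ with these marginals; no other condition is imposed on the choice. $\Pi(\mu,\sigma)$ is the set of Borel probability measures on $X\times Y$ whose $X$-marginal is $\mu$ and whose $Y$-marginal is $\sigma$-invariant. *)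

theory Defs
  imports "HOL-Probability.Probability"
begin

(* Y is the type nat => 'd with 'd :: {finite, discrete_topology}: sequences over a finite
   alphabet of CARD('d) letters, with the product topology of the function type.
   Borel probability measures on a topological space are the elements of
   space (prob_algebra borel).  On products this is the Borel sigma-algebra of the product
   topology, not the product sigma-algebra; no separability class is assumed. *)

definition seq_shift :: "(nat \<Rightarrow> 'd) \<Rightarrow> nat \<Rightarrow> 'd" where
  "seq_shift y = (\<lambda>i. y (Suc i))"

definition shift_invariant :: "(nat \<Rightarrow> 'd::topological_space) measure \<Rightarrow> bool" where
  "shift_invariant \<nu> \<longleftrightarrow> \<nu> \<in> space (prob_algebra borel) \<and> distr \<nu> borel seq_shift = \<nu>"

(* The push-forward of the uniform distribution on {0, ..., n-1} along the orbit of y, that is,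
   the average of the n Dirac measures; see emeasure_orbit_measure. *)
definition orbit_measure :: "nat \<Rightarrow> (nat \<Rightarrow> 'd::topological_space) \<Rightarrow> (nat \<Rightarrow> 'd) measure" where
  "orbit_measure n y = distr (uniform_count_measure {..<n}) borel (\<lambda>i. (seq_shift ^^ i) y)"

(* n need not be the least period.  As this is a set of measures, points of the same orbit
   contribute a single element. *)
definition Fix :: "nat \<Rightarrow> (nat \<Rightarrow> 'd::topological_space) measure set" where
  "Fix n = {orbit_measure n y | y. (seq_shift ^^ n) y = y}"

definition plans ::
  "'a::topological_space measure \<Rightarrow> 'b::topological_space measure \<Rightarrow> ('a \<times> 'b) measure set" where
  "plans \<mu> \<nu> = {\<pi> \<in> space (prob_algebra borel). distr \<pi> borel fst = \<mu> \<and> distr \<pi> borel snd = \<nu>}"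

definition maximizing_plan ::
  "('a::topological_space \<times> 'b::topological_space \<Rightarrow> real) \<Rightarrow> 'a measure \<Rightarrow> 'b measure \<Rightarrow>
    ('a \<times> 'b) measure \<Rightarrow> bool" where
  "maximizing_plan c \<mu> \<nu> \<pi> \<longleftrightarrow>
    \<pi> \<in> plans \<mu> \<nu> \<and> (\<forall>\<pi>'\<in>plans \<mu> \<nu>. integral\<^sup>L \<pi>' c \<le> integral\<^sup>L \<pi> c)"

definition invariant_plans ::
  "'a::topological_space measure \<Rightarrow> ('a \<times> (nat \<Rightarrow> 'd::topological_space)) measure set" where
  "invariant_plans \<mu> =
    {\<pi> \<in> space (prob_algebra borel). distr \<pi> borel fst = \<mu> \<and> shift_invariant (distr \<pi> borel snd)}"

definition gibbs_weight ::
  "('a::topological_space \<times> (nat \<Rightarrow> 'd::topological_space) \<Rightarrow> real) \<Rightarrow>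
    ((nat \<Rightarrow> 'd) measure \<Rightarrow> ('a \<times> (nat \<Rightarrow> 'd)) measure) \<Rightarrow>
    real \<Rightarrow> nat \<Rightarrow> (nat \<Rightarrow> 'd) measure \<Rightarrow> real" where
  "gibbs_weight c P \<beta> n \<nu> = exp (\<beta> * real n * integral\<^sup>L (P \<nu>) c)"

(* The mixture of the plans P \<nu> with normalized weights; integral_zeta and zeta_borel_prob below
   show that it is the Borel probability measure defined by the quotient of sums over Fix n. *)
definition zeta ::
  "('a::topological_space \<times> (nat \<Rightarrow> 'd::topological_space) \<Rightarrow> real) \<Rightarrow>
    ((nat \<Rightarrow> 'd) measure \<Rightarrow> ('a \<times> (nat \<Rightarrow> 'd)) measure) \<Rightarrow>
    real \<Rightarrow> nat \<Rightarrow> ('a \<times> (nat \<Rightarrow> 'd)) measure" where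
  "zeta c P \<beta> n =
    point_measure (Fix n)
      (\<lambda>\<nu>. ennreal (gibbs_weight c P \<beta> n \<nu> / (\<Sum>\<nu>'\<in>Fix n. gibbs_weight c P \<beta> n \<nu>'))) \<bind> P"

(* On a compact space every continuous function is bounded, so this is convergence against all
   of C(X). *)
definition weak_star_tendsto ::
  "(nat \<Rightarrow> 'a::topological_space measure) \<Rightarrow> 'a measure \<Rightarrow> bool" where
  "weak_star_tendsto M L \<longleftrightarrow>
    (\<forall>w :: 'a \<Rightarrow> real. continuous_on UNIV w \<longrightarrow>
      (\<lambda>j. integral\<^sup>L (M j) w) \<longlonglongrightarrow> integral\<^sup>L L w)"

lemma measurable_seq_shift:
  "seq_shift \<in> borel_measurable (borel :: (nat \<Rightarrow> 'd::topological_space) measure)"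
  unfolding seq_shift_def
  by (intro borel_measurable_continuous_onI continuous_on_coordinatewise_then_product
      continuous_on_product_coordinates)

lemma emeasure_orbit_measure:
  assumes "n \<ge> 1" "A \<in> sets borel"
  shows "emeasure (orbit_measure n y) A =
    ennreal ((\<Sum>i<n. indicator A ((seq_shift ^^ i) y)) / real n)"
proof -
  let ?f = "\<lambda>i. (seq_shift ^^ i) y"
  have "emeasure (orbit_measure n y) A = emeasure (uniform_count_measure {..<n}) (?f -` A \<inter> {..<n})"
    unfolding orbit_measure_def using assms
    by (subst emeasure_distr)
      (auto simp: space_uniform_count_measure uniform_count_measure_def space_point_measure)
  also have "\<dots> = ennreal (card (?f -` A \<inter> {..<n}) / real n)"
    by (subst emeasure_uniform_count_measure) auto
  also have "real (card (?f -` A \<inter> {..<n})) = (\<Sum>i<n. indicator A (?f i))"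
  proof -
    have "(\<Sum>i<n. indicator A (?f i) :: real) = (\<Sum>i<n. indicator (?f -` A) i)"
      by (simp add: indicator_def)
    also have "\<dots> = card (?f -` A \<inter> {..<n})"
      by (simp add: indicator_def sum.If_cases Int_commute vimage_def Collect_conj_eq)
    finally show ?thesis by simp
  qed
  finally show ?thesis by simp
qed

lemma funpow_seq_shift: "(seq_shift ^^ n) y = (\<lambda>i. y (i + n))"
  by (induction n) (auto simp: seq_shift_def fun_eq_iff)

lemma finite_Fix: "finite (Fix n :: (nat \<Rightarrow> 'd::{finite,topological_space}) measure set)" if "n \<ge> 1"
proof -
  have per: "y i = y (i mod n)" if "(seq_shift ^^ n) y = y" for y :: "nat \<Rightarrow> 'd" and i
  proof (induction i rule: less_induct)
    case (less i)
    show ?case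
    proof (cases "i < n")
      case False
      have "y i = (seq_shift ^^ n) y (i - n)"
        using False by (simp add: funpow_seq_shift)
      also have "\<dots> = y (i mod n)"
        using less.IH[of "i - n"] that False \<open>n \<ge> 1\<close> by (simp add: le_mod_geq)
      finally show ?thesis .
    qed simp
  qed
  have "Fix n \<subseteq> (\<lambda>f. orbit_measure n (\<lambda>i. f (i mod n))) ` (PiE {..<n} (\<lambda>_. UNIV :: 'd set))"
  proof
    fix \<nu> :: "(nat \<Rightarrow> 'd) measure" assume "\<nu> \<in> Fix n"
    then obtain y where y: "(seq_shift ^^ n) y = y" "\<nu> = orbit_measure n y"
      by (auto simp: Fix_def)
    have "y = (\<lambda>i. restrict y {..<n} (i mod n))"
    proof
      fix i
      show "y i = restrict y {..<n} (i mod n)"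
        using per[OF y(1), of i] \<open>n \<ge> 1\<close> by simp
    qed
    then have "\<nu> = orbit_measure n (\<lambda>i. restrict y {..<n} (i mod n))"
      using y(2) by simp
    then show "\<nu> \<in> (\<lambda>f. orbit_measure n (\<lambda>i. f (i mod n))) ` (PiE {..<n} (\<lambda>_. UNIV))"
      by (rule image_eqI[where x = "restrict y {..<n}"]) auto
  qed
  then show ?thesis
    by (rule finite_subset) (intro finite_imageI finite_PiE, auto)
qed

lemma Fix_nonempty: "Fix n \<noteq> {}"
proof -
  have "(seq_shift ^^ n) (\<lambda>_. undefined) = (\<lambda>_. undefined)"
    by (simp add: funpow_seq_shift)
  then show ?thesis by (auto simp: Fix_def)
qed

context
  fixes c :: "'a::topological_space \<times> (nat \<Rightarrow> 'd::{finite,topological_space}) \<Rightarrow> real"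
    and P :: "(nat \<Rightarrow> 'd) measure \<Rightarrow> ('a \<times> (nat \<Rightarrow> 'd)) measure" and \<beta> :: real and n :: nat
  assumes n: "n \<ge> 1" and P: "\<And>\<nu>. \<nu> \<in> Fix n \<Longrightarrow> P \<nu> \<in> space (prob_algebra borel)"
begin

private abbreviation "W \<equiv> gibbs_weight c P \<beta> n"
private abbreviation "Z \<equiv> (\<Sum>\<nu>\<in>Fix n. W \<nu>)"
private abbreviation "Q \<equiv> point_measure (Fix n) (\<lambda>\<nu>. ennreal (W \<nu> / Z))"

private lemma Z_pos: "Z > 0"
  by (rule sum_pos) (auto simp: finite_Fix[OF n] Fix_nonempty gibbs_weight_def)

private lemma prob_Q: "prob_space Q"
proof
  have "emeasure Q (space Q) = (\<Sum>\<nu>\<in>Fix n. ennreal (W \<nu> / Z))"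
    by (simp add: emeasure_point_measure_finite finite_Fix[OF n] space_point_measure)
  also have "\<dots> = ennreal (\<Sum>\<nu>\<in>Fix n. W \<nu> / Z)"
    using Z_pos by (intro sum_ennreal) (auto simp: gibbs_weight_def)
  also have "\<dots> = 1"
    using Z_pos by (simp flip: sum_divide_distrib)
  finally show "emeasure Q (space Q) = 1" .
qed

private lemma P_kernel: "P \<in> measurable Q (prob_algebra borel)"
  using P by auto

lemma zeta_borel_prob: "zeta c P \<beta> n \<in> space (prob_algebra borel)"
proof -
  have "Q \<in> space (prob_algebra Q)"
    using prob_Q by (simp add: space_prob_algebra)
  then have "prob_space (Q \<bind> P)" "sets (Q \<bind> P) = sets borel"
    using P_kernel by (rule prob_space_bind', rule sets_bind')
  then show ?thesis
    by (simp add: zeta_def space_prob_algebra)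
qed

lemma integral_zeta:
  fixes w :: "'a \<times> (nat \<Rightarrow> 'd) \<Rightarrow> real"
  assumes "continuous_on UNIV w" "bounded (range w)"
  shows "integral\<^sup>L (zeta c P \<beta> n) w =
    (\<Sum>\<nu>\<in>Fix n. exp (\<beta> * real n * integral\<^sup>L (P \<nu>) c) * integral\<^sup>L (P \<nu>) w) /
    (\<Sum>\<nu>\<in>Fix n. exp (\<beta> * real n * integral\<^sup>L (P \<nu>) c))"
proof -
  interpret Q: prob_space Q by (rule prob_Q)
  obtain B where B: "\<And>z. \<bar>w z\<bar> \<le> B"
    using assms(2) by (auto simp: bounded_iff)
  have k: "P \<in> measurable Q (subprob_algebra borel)"
    using P_kernel by (rule measurable_prob_algebraD)
  have "integral\<^sup>L (Q \<bind> P) w = (\<integral>\<nu>. integral\<^sup>L (P \<nu>) w \<partial>Q)"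
  proof (rule integral_bind[where B = B and B' = 1 and K = borel])
    show "w \<in> borel_measurable borel"
      using assms(1) by (rule borel_measurable_continuous_onI)
    show "AE \<nu> in Q. emeasure (P \<nu>) (space (P \<nu>)) \<le> ennreal 1"
      using P by (auto simp: space_point_measure space_prob_algebra prob_space.emeasure_space_1
          intro!: AE_I2)
  qed (use B k in \<open>auto intro: Q.finite_measure_axioms\<close>)
  also have "\<dots> = (\<Sum>\<nu>\<in>Fix n. W \<nu> / Z * integral\<^sup>L (P \<nu>) w)"
    using Z_pos
    by (subst lebesgue_integral_point_measure_finite) (auto simp: finite_Fix[OF n] gibbs_weight_def)
  also have "\<dots> = (\<Sum>\<nu>\<in>Fix n. W \<nu> * integral\<^sup>L (P \<nu>) w) / Z"
    by (simp add: sum_divide_distrib)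
  finally show ?thesis
    by (simp add: zeta_def gibbs_weight_def)
qed

end

end

(* Fixing x, a continuous c(x, y) depends on y only through finitely many letters, up to a small error.
   Given an invariant plan pi with Y-marginal nu, cut a long period n into blocks of length L and fill
   them with the words of length L, each used in proportion to its nu-probability.  By invariance of nu
   the resulting periodic point visits every short cylinder with frequency at least nu of that cylinder
   minus e.  Hence a coupling moves nu to the periodic orbit measure while changing the first k letters
   only with small probability; applied to the second coordinate of pi it gives a plan from mu to a
   measure in Fix n whose c-integral is almost that of pi.

   The Gibbs inequality bounds the mean of log-weights below by the largest one minus ln (card (Fix n)),
   and card (Fix n) <= d^n, so the c-integral of zeta falls short of max over Fix n by at most
   (ln d)/beta, uniformly in n. *)
theory Submission
  imports Defs
begin

subsection \<open>Cylinders and uniqueness of measures\<close>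

text \<open>Weak approximation of \<nu> by orbit measures would not suffice: a competitor in
  \<open>plans \<mu> \<nu>'\<close> must have first marginal exactly \<mu>. Therefore mass is moved
  in the second coordinate only, by a coupling that carries x along unchanged. Lower bounds on the
  frequencies are enough for this: the cylinder probabilities and the visit frequencies both sum to
  1, so one-sided bounds already control the total mass to be moved.

  That the limit is an invariant plan is a separate, softer argument: each \<open>zeta\<close>
  satisfies linear identities for continuous functions of one coordinate, these pass to the limit,
  and such functions determine Borel measures on X and on Y separately. Both arguments treat the
  projections as continuous maps, so the Borel sets of the product space are never compared with the
  product sigma-algebra.\<close>

definition cylinder :: "nat \<Rightarrow> (nat \<Rightarrow> 'd) \<Rightarrow> (nat \<Rightarrow> 'd) set" where
  "cylinder k y = {y'. \<forall>i<k. y' i = y i}"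

lemma cylinder_self: "y \<in> cylinder k y"
  by (simp add: cylinder_def)

lemma cylinder_antimono: "k \<le> l \<Longrightarrow> cylinder l y \<subseteq> cylinder k y"
  by (auto simp: cylinder_def)

lemma cylinder_eq: "y' \<in> cylinder k y \<Longrightarrow> cylinder k y' = cylinder k y"
  by (auto simp: cylinder_def)

lemma open_cylinder: "open (cylinder k y :: (nat \<Rightarrow> 'd::discrete_topology) set)"
proof -
  have "cylinder k y = (\<Inter>i\<in>{..<k}. (\<lambda>y'. y' i) -` {y i})"
    by (auto simp: cylinder_def)
  moreover have "open ((\<lambda>y' :: nat \<Rightarrow> 'd. y' i) -` {y i})" for i
    by (intro open_vimage Topological_Spaces.open_discrete continuous_on_product_coordinates)
  ultimately show ?thesis by auto
qed

lemma open_contains_cylinder: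
  fixes U :: "(nat \<Rightarrow> 'd::discrete_topology) set"
  assumes "open U" "y \<in> U"
  obtains k where "cylinder k y \<subseteq> U"
proof -
  obtain X where X: "y \<in> Pi\<^sub>E UNIV X" "finite {i. X i \<noteq> UNIV}" "Pi\<^sub>E UNIV X \<subseteq> U"
    using product_topology_open_contains_basis[of "\<lambda>_. euclidean" UNIV U y] assms
    by (auto simp: open_fun_def)
  obtain k where k: "{i. X i \<noteq> UNIV} \<subseteq> {..<k}"
    using X(2) finite_nat_iff_bounded by blast
  have "cylinder k y \<subseteq> Pi\<^sub>E UNIV X"
  proof
    fix y' assume y': "y' \<in> cylinder k y"
    have "y' i \<in> X i" for i
      using X(1) k y' by (cases "i < k") (auto simp: PiE_iff cylinder_def)
    then show "y' \<in> Pi\<^sub>E UNIV X" by auto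
  qed
  with X(3) show ?thesis using that by blast
qed

lemma compact_UNIV_seq: "compact (UNIV :: (nat \<Rightarrow> 'd::{finite,topological_space}) set)"
proof -
  have "compact_space (product_topology (\<lambda>_::nat. euclidean :: 'd topology) UNIV)"
    by (simp add: compact_space_product_topology, simp add: compact_space_def finite_imp_compact)
  then show ?thesis
    by (simp add: compact_space_def euclidean_product_topology)
qed

lemma compact_UNIV_Times:
  assumes "compact (UNIV :: 'x::topological_space set)"
  shows "compact (UNIV :: ('x \<times> (nat \<Rightarrow> 'd::{finite,topological_space})) set)"
  using compact_Times[OF assms compact_UNIV_seq] by simp

text \<open>One \<open>k\<close> must serve all \<open>x\<close> at once. Compactness of the product
  gives it: finitely many boxes, open set times cylinder, cover the space, and \<open>c\<close>
  varies by less than \<open>e / 2\<close> from the centre of each.\<close>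

lemma uniformly_continuous_snd:
  fixes c :: "'x::topological_space \<times> (nat \<Rightarrow> 'd::{finite,discrete_topology}) \<Rightarrow> real"
  assumes X: "compact (UNIV :: 'x set)" and c: "continuous_on UNIV c" and "e > 0"
  obtains k where "\<And>x y y'. y' \<in> cylinder k y \<Longrightarrow> \<bar>c (x, y') - c (x, y)\<bar> < e"
proof -
  have "\<exists>A k. open A \<and> fst z \<in> A \<and>
      (\<forall>z'\<in>A \<times> cylinder k (snd z). \<bar>c z' - c z\<bar> < e / 2)" for z
  proof -
    have "open (c -` ball (c z) (e / 2))"
      using c by (intro open_vimage) auto
    moreover have "z \<in> c -` ball (c z) (e / 2)"
      using \<open>e > 0\<close> by simp
    ultimately obtain A B where AB: "open A" "open B" "z \<in> A \<times> B"
        "A \<times> B \<subseteq> c -` ball (c z) (e / 2)"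
      by (rule open_prod_elim)
    obtain k where "cylinder k (snd z) \<subseteq> B"
      using open_contains_cylinder[OF AB(2), of "snd z"] AB(3) mem_Times_iff by metis
    then have "A \<times> cylinder k (snd z) \<subseteq> c -` ball (c z) (e / 2)"
      using AB(4) by blast
    then have "\<forall>z'\<in>A \<times> cylinder k (snd z). \<bar>c z' - c z\<bar> < e / 2"
      by (auto simp: dist_real_def abs_minus_commute)
    with AB show ?thesis by (metis mem_Times_iff)
  qed
  then obtain A k where A: "\<And>z. open (A z)" "\<And>z. fst z \<in> A z"
    and k: "\<And>z z'. z' \<in> A z \<times> cylinder (k z) (snd z) \<Longrightarrow> \<bar>c z' - c z\<bar> < e / 2"
    by metis
  obtain F where F: "finite F" "UNIV \<subseteq> (\<Union>z\<in>F. A z \<times> cylinder (k z) (snd z))"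
  proof (rule compactE_image[OF compact_UNIV_Times[OF X]])
    show "UNIV \<subseteq> (\<Union>z\<in>UNIV. A z \<times> cylinder (k z) (snd z))"
      using A(2) cylinder_self by (fastforce simp: mem_Times_iff)
  qed (auto intro: open_Times A open_cylinder)
  show ?thesis
  proof (rule that)
    fix x :: 'x and y y' :: "nat \<Rightarrow> 'd"
    assume y': "y' \<in> cylinder (Max (k ` F)) y"
    obtain z where z: "z \<in> F" "(x, y) \<in> A z \<times> cylinder (k z) (snd z)"
      using F(2) by blast
    have "y' \<in> cylinder (k z) y"
      \<comment> \<open>With the largest length occurring in the cover, changing later letters
        cannot leave whichever box contains \<open>(x, y)\<close>.\<close>
      using y' cylinder_antimono[of "k z" "Max (k ` F)" y] F(1) z(1) by auto
    then have "(x, y') \<in> A z \<times> cylinder (k z) (snd z)"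
      using z(2) cylinder_eq by auto
    from k[OF this] k[OF z(2)] show "\<bar>c (x, y') - c (x, y)\<bar> < e"
      by linarith
  qed
qed

text \<open>Closed sets form an intersection-stable generator, and dominated convergence recovers
  their measure from the approximating functions. The approximation is left as a hypothesis because
  X and the sequence space supply it in different ways.\<close>

lemma measure_eqI_continuous:
  fixes M N :: "'a::topological_space measure"
  assumes fin: "finite_measure M" "finite_measure N"
    and sets: "sets M = sets borel" "sets N = sets borel"
    and eq: "\<And>f :: 'a \<Rightarrow> real. continuous_on UNIV f \<Longrightarrow> (\<And>x. \<bar>f x\<bar> \<le> 1) \<Longrightarrow>
      integral\<^sup>L M f = integral\<^sup>L N f"
    and approx: "\<And>C :: 'a set. closed C \<Longrightarrow> \<exists>f :: nat \<Rightarrow> 'a \<Rightarrow> real.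
      (\<forall>i. continuous_on UNIV (f i)) \<and> (\<forall>i x. \<bar>f i x\<bar> \<le> 1) \<and>
      (\<forall>x. (\<lambda>i. f i x) \<longlonglongrightarrow> indicator C x)"
  shows "M = N"
proof (rule measure_eqI_generator_eq)
  interpret M: finite_measure M by fact
  interpret N: finite_measure N by fact
  have sp: "space M = UNIV" "space N = UNIV"
    using sets by (auto dest: sets_eq_imp_space_eq)
  have ms: "borel_measurable M = borel_measurable borel" "borel_measurable N = borel_measurable borel"
    using sets by (auto intro: measurable_cong_sets)
  show "emeasure M C = emeasure N C" if "C \<in> Collect closed" for C
  proof -
    have C: "C \<in> sets borel" using that by auto
    have "closed C" using that by simp
    from approx[OF this] obtain f :: "nat \<Rightarrow> 'a \<Rightarrow> real"
      where "(\<forall>i. continuous_on UNIV (f i)) \<and> (\<forall>i x. \<bar>f i x\<bar> \<le> 1) \<and>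
        (\<forall>x. (\<lambda>i. f i x) \<longlonglongrightarrow> indicator C x)" ..
    then have f: "\<And>i. continuous_on UNIV (f i)" "\<And>i x. \<bar>f i x\<bar> \<le> 1"
      "\<And>x. (\<lambda>i. f i x) \<longlonglongrightarrow> indicator C x" by simp_all
    have m: "f i \<in> borel_measurable borel" for i
      using f(1) by (rule borel_measurable_continuous_onI)
    have "(\<lambda>i. integral\<^sup>L M (f i)) \<longlonglongrightarrow> integral\<^sup>L M (indicator C)"
      by (rule integral_dominated_convergence[where w="\<lambda>_. 1"])
        (use C in \<open>auto simp: ms m f intro: borel_measurable_indicator\<close>)
    moreover have "(\<lambda>i. integral\<^sup>L N (f i)) \<longlonglongrightarrow> integral\<^sup>L N (indicator C)"
      by (rule integral_dominated_convergence[where w="\<lambda>_. 1"])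
        (use C in \<open>auto simp: ms m f intro: borel_measurable_indicator\<close>)
    ultimately have "integral\<^sup>L M (indicator C :: 'a \<Rightarrow> real) = integral\<^sup>L N (indicator C)"
      using eq f by (auto intro: LIMSEQ_unique)
    then show ?thesis
      using C sets sp by (simp add: M.emeasure_eq_measure N.emeasure_eq_measure)
  qed
  show "Int_stable (Collect closed :: 'a set set)"
    by (auto simp: Int_stable_def)
  show "sets M = sigma_sets UNIV (Collect closed)" "sets N = sigma_sets UNIV (Collect closed)"
    using sets by (simp_all add: borel_eq_closed)
  show "range (\<lambda>_. UNIV) \<subseteq> Collect (closed :: 'a set \<Rightarrow> bool)" by auto
qed (use fin in \<open>auto simp: finite_measure.emeasure_finite\<close>)

lemma measure_eqI_continuous_metric:
  fixes M N :: "'a::metric_space measure"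
  assumes "finite_measure M" "finite_measure N"
    and "sets M = sets borel" "sets N = sets borel"
    and "\<And>f :: 'a \<Rightarrow> real. continuous_on UNIV f \<Longrightarrow> (\<And>x. \<bar>f x\<bar> \<le> 1) \<Longrightarrow>
      integral\<^sup>L M f = integral\<^sup>L N f"
  shows "M = N"
proof (rule measure_eqI_continuous[OF assms], assumption)
  fix C :: "'a set" assume "closed C"
  show "\<exists>f :: nat \<Rightarrow> 'a \<Rightarrow> real. (\<forall>i. continuous_on UNIV (f i)) \<and> (\<forall>i x. \<bar>f i x\<bar> \<le> 1) \<and>
      (\<forall>x. (\<lambda>i. f i x) \<longlonglongrightarrow> indicator C x)"
  \<comment> \<open>\<open>infdist x {}\<close> is 0 by convention, so the functions used below
    would be constantly 1 for the empty set.\<close>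
  proof (cases "C = {}")
    case True
    then show ?thesis by (intro exI[of _ "\<lambda>_ _. 0"]) auto
  next
    case False
    define f :: "nat \<Rightarrow> 'a \<Rightarrow> real" where "f i x = max 0 (1 - real i * infdist x C)" for i x
    have "(\<lambda>i. f i x) \<longlonglongrightarrow> indicator C x" for x
    proof (cases "x \<in> C")
      case True
      then show ?thesis by (simp add: f_def)
    next
      case x: False
      then have pos: "infdist x C > 0"
        using \<open>closed C\<close> False by (simp add: infdist_pos_not_in_closed)
      obtain i0 where i0: "1 < real i0 * infdist x C"
        using reals_Archimedean3[OF pos] by blast
      have "f i x = 0" if "i \<ge> i0" for i
      proof -
        have "real i0 * infdist x C \<le> real i * infdist x C"
          using that pos by simp
        with i0 show ?thesis by (simp add: f_def)
      qed
      then show ?thesis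
        using x by (auto intro!: tendsto_eventually eventually_sequentiallyI)
    qed
    moreover have "continuous_on UNIV (f i)" for i
      unfolding f_def by (intro continuous_intros)
    moreover have "\<bar>f i x\<bar> \<le> 1" for i x
      by (auto simp: f_def infdist_nonneg)
    ultimately show ?thesis by blast
  qed
qed

text \<open>In place of a distance function, C is approximated by the union \<open>U i\<close> of
  the length-\<open>i\<close> cylinders that meet it. \<open>U i\<close> and its complement are both
  unions of such cylinders, so the indicator is continuous; a point outside the closed set C has a
  cylinder that misses C.\<close>

lemma measure_eqI_continuous_seq:
  fixes M N :: "(nat \<Rightarrow> 'd::discrete_topology) measure"
  assumes "finite_measure M" "finite_measure N"
    and "sets M = sets borel" "sets N = sets borel"
    and "\<And>f :: (nat \<Rightarrow> 'd) \<Rightarrow> real. continuous_on UNIV f \<Longrightarrow> (\<And>x. \<bar>f x\<bar> \<le> 1) \<Longrightarrow>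
      integral\<^sup>L M f = integral\<^sup>L N f"
  shows "M = N"
proof (rule measure_eqI_continuous[OF assms], assumption)
  fix C :: "(nat \<Rightarrow> 'd) set" assume C: "closed C"
  define U where "U i = (\<Union>y\<in>C. cylinder i y)" for i
  have U: "y' \<in> U i \<longleftrightarrow> y \<in> U i" if "y' \<in> cylinder i y" for y y' i
    using that unfolding U_def cylinder_def by auto
  have op: "open (U i)" "open (- U i)" for i
  proof -
    show "open (U i)" by (auto simp: U_def intro: open_cylinder)
    have "- U i = (\<Union>y\<in>- U i. cylinder i y)"
      using U cylinder_self by fast
    then show "open (- U i)"
      by (metis open_UN open_cylinder)
  qed
  have "(\<lambda>i. indicat_real (U i) y) \<longlonglongrightarrow> indicator C y" for y
  proof (cases "y \<in> C")
    case True
    then have "y \<in> U i" for i using cylinder_self by (auto simp: U_def)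
    with True show ?thesis by simp
  next
    case False
    obtain k where k: "cylinder k y \<subseteq> - C"
      using open_contains_cylinder[of "- C" y] C False by auto
    have "y \<notin> U i" if "i \<ge> k" for i
      using k that by (force simp: U_def cylinder_def)
    then show ?thesis
      using False by (auto intro!: tendsto_eventually eventually_sequentiallyI[of k])
  qed
  moreover have "continuous_on UNIV (indicat_real (U i))" for i
  proof -
    have "continuous_on (U i \<union> - U i) (indicat_real (U i))"
    proof (rule continuous_on_open_Un[OF op])
      show "continuous_on (U i) (indicat_real (U i))"
        by (rule continuous_on_eq[OF continuous_on_const[of _ 1]]) simp
      show "continuous_on (- U i) (indicat_real (U i))"
        by (rule continuous_on_eq[OF continuous_on_const[of _ 0]]) simp
    qed
    then show ?thesis by simp
  qed
  ultimately show "\<exists>f :: nat \<Rightarrow> (nat \<Rightarrow> 'd) \<Rightarrow> real. (\<forall>i. continuous_on UNIV (f i)) \<and>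
      (\<forall>i x. \<bar>f i x\<bar> \<le> 1) \<and> (\<forall>x. (\<lambda>i. f i x) \<longlonglongrightarrow> indicator C x)"
    by (intro exI[of _ "\<lambda>i. indicator (U i)"]) auto
qed

subsection \<open>Periodic orbit measures and Gibbs means\<close>

text \<open>A periodic point is determined by its first \<open>n\<close> letters. An orbit may be
  counted several times here, but only the exponential growth rate of the bound matters
  later.\<close>

lemma card_Fix_le:
  assumes "n \<ge> 1"
  shows "card (Fix n :: (nat \<Rightarrow> 'd::{finite,topological_space}) measure set) \<le> CARD('d) ^ n"
proof -
  let ?g = "\<lambda>f :: nat \<Rightarrow> 'd. orbit_measure n (\<lambda>i. f (i mod n))"
  have "Fix n \<subseteq> ?g ` PiE {..<n} (\<lambda>_. UNIV)"
  proof
    fix \<nu> :: "(nat \<Rightarrow> 'd) measure" assume "\<nu> \<in> Fix n"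
    then obtain y where y: "(seq_shift ^^ n) y = y" "\<nu> = orbit_measure n y"
      by (auto simp: Fix_def)
    show "\<nu> \<in> ?g ` PiE {..<n} (\<lambda>_. UNIV)"
    proof (rule image_eqI[where x = "restrict y {..<n}"])
      have "((seq_shift ^^ n) ^^ q) y = y" for q
        using y(1) by (induction q) auto
      then have "(seq_shift ^^ (n * q)) y = y" for q
        by (simp add: funpow_mult)
      then have "y (i + n * q) = y i" for i q
        by (metis funpow_seq_shift)
      then have "y (i mod n) = y i" for i
        by (metis mod_mult_div_eq)
      then show "\<nu> = ?g (restrict y {..<n})"
        using \<open>n \<ge> 1\<close> y(2) by simp
    qed auto
  qed
  then have "card (Fix n :: (nat \<Rightarrow> 'd) measure set) \<le> card (?g ` PiE {..<n} (\<lambda>_. UNIV))"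
    by (intro card_mono finite_imageI finite_PiE) auto
  also have "\<dots> \<le> card (PiE {..<n} (\<lambda>_. UNIV :: 'd set))"
    by (intro card_image_le finite_PiE) auto
  also have "\<dots> = CARD('d) ^ n"
    by (simp add: card_PiE)
  finally show ?thesis .
qed

text \<open>Jensen's inequality for \<open>exp\<close>: under the Gibbs weights, the mean of \<open>exp (- s x)\<close> is
  \<open>card A\<close> divided by the partition function.\<close>
lemma gibbs_mean_ge:
  fixes s :: "'a \<Rightarrow> real"
  assumes "finite A" "a \<in> A"
  shows "s a - ln (card A) \<le> (\<Sum>x\<in>A. exp (s x) * s x) / (\<Sum>x\<in>A. exp (s x))"
proof -
  define Z where "Z = (\<Sum>x\<in>A. exp (s x))"
  define m where "m = (\<Sum>x\<in>A. exp (s x) * s x) / Z"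
  have A: "card A > 0" using assms card_gt_0_iff by blast
  have Z: "exp (s a) \<le> Z"
    unfolding Z_def using assms by (intro member_le_sum) auto
  then have "Z > 0" using exp_gt_zero[of "s a"] by linarith
  \<comment> \<open>\<open>exp (- s x)\<close> is bounded below by its tangent line at
    \<open>m\<close>. Since \<open>m\<close> is the Gibbs mean, the linear terms cancel in the sum
    and \<open>exp (- m) * Z\<close> remains.\<close>
  have "(\<Sum>x\<in>A. exp (s x) * (exp (- m) * (1 - (s x - m)))) \<le> (\<Sum>x\<in>A. 1 :: real)"
  proof (intro sum_mono)
    fix x
    have "exp (- m) * (1 - (s x - m)) \<le> exp (- m) * exp (- (s x - m))"
      using exp_ge_add_one_self[of "m - s x"] by (intro mult_left_mono) (auto simp: algebra_simps)
    also have "\<dots> = exp (- s x)" by (simp flip: exp_add)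
    finally show "exp (s x) * (exp (- m) * (1 - (s x - m))) \<le> 1"
      by (simp add: exp_minus field_simps)
  qed
  also have "(\<Sum>x\<in>A. exp (s x) * (exp (- m) * (1 - (s x - m)))) =
      exp (- m) * ((1 + m) * Z - (\<Sum>x\<in>A. exp (s x) * s x))"
    by (simp add: Z_def sum_distrib_left sum_subtractf algebra_simps sum.distrib)
  also have "(\<Sum>x\<in>A. exp (s x) * s x) = m * Z"
    using \<open>Z > 0\<close> by (simp add: m_def)
  finally have "exp (- m) * Z \<le> card A"
    by (simp add: algebra_simps)
  then have "exp (- m) * exp (s a) \<le> card A"
    using Z by (smt (verit) mult_left_mono exp_gt_zero)
  then have "exp (s a - m) \<le> exp (ln (card A))"
    using A by (simp add: exp_diff exp_minus field_simps)
  then show ?thesis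
    by (simp add: m_def Z_def)
qed

section \<open>Integrals against image measures and periodic orbit measures\<close>

lemma integral_distr_borel:
  fixes f :: "'b::topological_space \<Rightarrow> real"
  assumes "sets \<pi> = sets (borel :: 'a::topological_space measure)"
    and "continuous_on UNIV g" "continuous_on UNIV f"
  shows "integral\<^sup>L (distr \<pi> borel g) f = (\<integral>x. f (g x) \<partial>\<pi>)"
proof (rule integral_distr)
  show "g \<in> \<pi> \<rightarrow>\<^sub>M borel"
    using borel_measurable_continuous_onI[OF assms(2)] assms(1) measurable_cong_sets by blast
  show "f \<in> borel_measurable borel"
    using assms(3) by (rule borel_measurable_continuous_onI)
qed

lemma integral_orbit_measure:
  fixes f :: "(nat \<Rightarrow> 'd::topological_space) \<Rightarrow> real"
  assumes "n \<ge> 1" "f \<in> borel_measurable borel"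
  shows "integral\<^sup>L (orbit_measure n y) f = (\<Sum>i<n. f ((seq_shift ^^ i) y)) / n"
proof -
  have "integral\<^sup>L (orbit_measure n y) f =
      (\<integral>i. f ((seq_shift ^^ i) y) \<partial>uniform_count_measure {..<n})"
    unfolding orbit_measure_def using assms(2)
    by (intro integral_distr) (auto simp: uniform_count_measure_def space_point_measure)
  also have "\<dots> = (\<Sum>i<n. f ((seq_shift ^^ i) y)) / n"
    unfolding uniform_count_measure_def using assms(1)
    by (subst lebesgue_integral_point_measure_finite) (auto simp: sum_divide_distrib)
  finally show ?thesis .
qed

lemma continuous_on_seq_shift:
  "continuous_on UNIV (seq_shift :: (nat \<Rightarrow> 'd::topological_space) \<Rightarrow> _)"
  unfolding seq_shift_def
  by (intro continuous_on_coordinatewise_then_product continuous_on_product_coordinates)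

text \<open>The two orbit sums differ only in their end terms, which agree by periodicity.\<close>

lemma integral_Fix_shift:
  fixes f :: "(nat \<Rightarrow> 'd::topological_space) \<Rightarrow> real"
  assumes "n \<ge> 1" "\<nu> \<in> Fix n" "continuous_on UNIV f"
  shows "(\<integral>y. f (seq_shift y) \<partial>\<nu>) = integral\<^sup>L \<nu> f"
proof -
  obtain y where y: "(seq_shift ^^ n) y = y" "\<nu> = orbit_measure n y"
    using assms(2) by (auto simp: Fix_def)
  have m: "f \<in> borel_measurable borel" "(\<lambda>y. f (seq_shift y)) \<in> borel_measurable borel"
    using borel_measurable_continuous_onI[OF assms(3)]
    by (auto intro: measurable_compose[OF measurable_seq_shift])
  have "(\<Sum>i<n. f ((seq_shift ^^ Suc i) y)) - (\<Sum>i<n. f ((seq_shift ^^ i) y)) =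
      f ((seq_shift ^^ n) y) - f ((seq_shift ^^ 0) y)"
    by (subst sum_subtractf[symmetric], rule sum_lessThan_telescope)
  then show ?thesis
    using y m assms(1) by (simp add: integral_orbit_measure)
qed

subsection \<open>Periodic approximation of invariant measures\<close>

text \<open>Each new symbol takes the last \<open>N s\<close> positions and the induction hypothesis
  fills the shorter range before them, hence the generalization over \<open>m\<close>. Spare
  positions may hold anything.\<close>

lemma exists_multiplicities:
  fixes N :: "'s \<Rightarrow> nat"
  assumes "finite S" "sum N S \<le> m"
  shows "\<exists>u :: nat \<Rightarrow> 's. \<forall>s\<in>S. N s \<le> card {i. i < m \<and> u i = s}"
  using assms
proof (induction S arbitrary: m rule: finite_induct)
  case (insert s S)
  have le: "sum N S \<le> m - N s" "N s \<le> m"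
    using insert.prems insert.hyps by auto
  then obtain u :: "nat \<Rightarrow> 's" where u: "\<And>t. t \<in> S \<Longrightarrow> N t \<le> card {i. i < m - N s \<and> u i = t}"
    using insert.IH by blast
  define v where "v i = (if i < m - N s then u i else s)" for i
  have "N t \<le> card {i. i < m \<and> v i = t}" if "t \<in> insert s S" for t
  proof (cases "t = s")
    case True
    have "N s = card {m - N s..<m}" using le by simp
    also have "\<dots> \<le> card {i. i < m \<and> v i = s}"
      by (intro card_mono) (auto simp: v_def)
    finally show ?thesis using True by simp
  next
    case False
    then have "N t \<le> card {i. i < m - N s \<and> u i = t}"
      using u that by auto
    also have "\<dots> \<le> card {i. i < m \<and> v i = t}"
      by (intro card_mono) (auto simp: v_def)
    finally show ?thesis .
  qed
  then show ?case by blast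
qed simp

text \<open>Rounding \<open>m * p s\<close> down loses at most one occurrence of each symbol, so the
  error \<open>sum h S\<close> does not grow with \<open>m\<close>. The bound is phrased with a test
  function because \<open>h\<close> will count visits inside a block.\<close>

lemma quantization:
  fixes p :: "'s \<Rightarrow> real"
  assumes "finite S" "\<And>s. s \<in> S \<Longrightarrow> 0 \<le> p s" "sum p S \<le> 1"
  obtains u :: "nat \<Rightarrow> 's" where
    "\<And>h :: 's \<Rightarrow> real. (\<And>s. 0 \<le> h s) \<Longrightarrow>
      real m * (\<Sum>s\<in>S. p s * h s) - sum h S \<le> (\<Sum>i<m. h (u i))"
proof -
  define N where "N s = nat \<lfloor>real m * p s\<rfloor>" for s
  have N: "real (N s) \<le> real m * p s" "real m * p s - 1 \<le> real (N s)" if "s \<in> S" for s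
    using assms(2)[OF that] unfolding N_def by (simp, linarith)
  have "real (sum N S) \<le> (\<Sum>s\<in>S. real m * p s)"
    unfolding of_nat_sum by (intro sum_mono N)
  also have "\<dots> \<le> real m"
    using assms(3) by (simp flip: sum_distrib_left add: mult_left_le)
  finally have "sum N S \<le> m" by (simp only: of_nat_le_iff)
  then obtain u :: "nat \<Rightarrow> 's" where u: "\<And>s. s \<in> S \<Longrightarrow> N s \<le> card {i. i < m \<and> u i = s}"
    using exists_multiplicities[OF assms(1)] by blast
  show ?thesis
  proof (rule that)
    fix h :: "'s \<Rightarrow> real" assume h: "\<And>s. 0 \<le> h s"
    have "real m * (\<Sum>s\<in>S. p s * h s) - sum h S = (\<Sum>s\<in>S. (real m * p s - 1) * h s)"
      by (simp add: sum_distrib_left sum_subtractf algebra_simps)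
    also have "\<dots> \<le> (\<Sum>s\<in>S. real (card {i. i < m \<and> u i = s}) * h s)"
    proof (intro sum_mono mult_right_mono h)
      fix s assume "s \<in> S"
      then show "real m * p s - 1 \<le> real (card {i. i < m \<and> u i = s})"
        using N(2)[of s] u[of s] by linarith
    qed
    also have "\<dots> = (\<Sum>s\<in>S. \<Sum>i\<in>{i. i < m \<and> u i = s}. h (u i))"
      by simp
    also have "\<dots> = (\<Sum>i\<in>(\<Union>s\<in>S. {i. i < m \<and> u i = s}). h (u i))"
      using assms(1) by (intro sum.UNION_disjoint[symmetric]) auto
    also have "\<dots> \<le> (\<Sum>i<m. h (u i))"
      by (intro sum_mono2) (auto intro: h)
    finally show "real m * (\<Sum>s\<in>S. p s * h s) - sum h S \<le> (\<Sum>i<m. h (u i))" .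
  qed
qed

section \<open>Cylinder frequencies under an invariant measure\<close>

lemma sets_cylinder:
  "cylinder k w \<in> sets (borel :: (nat \<Rightarrow> 'd::discrete_topology) measure)"
  by (simp add: open_cylinder)

lemma measurable_funpow_seq_shift:
  "(seq_shift ^^ j) \<in> borel \<rightarrow>\<^sub>M (borel :: (nat \<Rightarrow> 'd::topological_space) measure)"
proof (induction j)
  case (Suc j)
  from measurable_comp[OF this measurable_seq_shift] show ?case by (simp add: comp_def)
qed (simp add: id_def)

lemma measure_shift_preimage:
  assumes "shift_invariant \<nu>" "A \<in> sets borel"
  shows "measure \<nu> {y. (seq_shift ^^ j) y \<in> A} = measure \<nu> A"
proof (induction j)
  case (Suc j)
  have s: "sets \<nu> = sets borel" and d: "distr \<nu> borel seq_shift = \<nu>"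
    using assms(1) by (auto simp: shift_invariant_def space_prob_algebra)
  have sp: "space \<nu> = UNIV" using s by (auto dest: sets_eq_imp_space_eq)
  have A: "{y. (seq_shift ^^ j) y \<in> A} \<in> sets borel"
    using measurable_sets[OF measurable_funpow_seq_shift assms(2)] by (simp add: vimage_def)
  have "measure \<nu> {y. (seq_shift ^^ j) y \<in> A} = measure (distr \<nu> borel seq_shift) {y. (seq_shift ^^ j) y \<in> A}"
    by (simp add: d)
  also have "\<dots> = measure \<nu> {y. (seq_shift ^^ j) (seq_shift y) \<in> A}"
    using A measurable_seq_shift measurable_cong_sets[OF s refl]
    by (subst measure_distr) (auto simp: sp vimage_def)
  finally show ?case using Suc by (simp add: funpow_swap1)
qed simp

lemma finite_words: "finite (PiE {..<L :: nat} (\<lambda>_. UNIV :: 'd::finite set))"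
  by (intro finite_PiE) auto

text \<open>A word of length \<open>L\<close> is encoded as an extensional function,
  \<open>undefined\<close> from \<open>L\<close> on, so that it can itself be the base point of a
  cylinder.\<close>

lemma cylinder_word_iff:
  "s \<in> PiE {..<L} (\<lambda>_. UNIV) \<Longrightarrow> y \<in> cylinder L s \<longleftrightarrow> restrict y {..<L} = s"
  by (auto simp: cylinder_def PiE_iff extensional_def restrict_def fun_eq_iff)

text \<open>Only the word read off from \<open>y\<close> contributes. This turns the integral of a
  function of the first \<open>L\<close> letters into a finite sum over words.\<close>

lemma sum_cylinder_words:
  fixes h :: "(nat \<Rightarrow> 'd::finite) \<Rightarrow> real"
  assumes "\<And>y y'. y' \<in> cylinder L y \<Longrightarrow> h y' = h y"
  shows "(\<Sum>s\<in>PiE {..<L} (\<lambda>_. UNIV). indicator (cylinder L s) y * h s) = h y"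
proof -
  let ?s = "restrict y {..<L}"
  have "(\<Sum>s\<in>PiE {..<L} (\<lambda>_. UNIV). indicator (cylinder L s) y * h s) =
      (\<Sum>s\<in>PiE {..<L} (\<lambda>_. UNIV). if s = ?s then h s else 0)"
    by (intro sum.cong) (auto simp: cylinder_word_iff indicator_def)
  also have "\<dots> = h ?s"
    by (subst sum.delta[OF finite_words]) auto
  also have "\<dots> = h y"
    by (rule assms) (auto simp: cylinder_def)
  finally show ?thesis .
qed

text \<open>The quantifier order matters: one \<open>z\<close> must work for all cylinders, since
  the coupling compares all words of length \<open>k\<close> simultaneously. It can, because
  \<open>z\<close> is built from the probabilities of the words of length \<open>L\<close>, and
  \<open>w\<close> enters only through the test function \<open>h\<close>.\<close>

lemma periodic_block_approximation:
  fixes \<nu> :: "(nat \<Rightarrow> 'd::{finite,discrete_topology}) measure"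
  assumes \<nu>: "shift_invariant \<nu>" and kL: "k \<le> L" "L \<ge> 1" and n: "n \<ge> 1"
  shows "\<exists>z. (seq_shift ^^ n) z = z \<and> (\<forall>w.
    real (n div L) * real (L - k) * measure \<nu> (cylinder k w) - real (CARD('d) ^ L) * real L \<le>
    (\<Sum>i<n. indicator (cylinder k w) ((seq_shift ^^ i) z)))"
proof -
  define S where "S = PiE {..<L} (\<lambda>_. UNIV :: 'd set)"
  define m where "m = n div L"
  have "prob_space \<nu>" and sets: "sets \<nu> = sets borel"
    using \<nu> by (auto simp: shift_invariant_def space_prob_algebra)
  then interpret \<nu>: prob_space \<nu> by simp
  have fin: "finite S" by (simp add: S_def finite_words)
  have cyl: "cylinder l w \<in> sets \<nu>" for l w
    by (simp add: sets sets_cylinder)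
  have word_sum: "(\<Sum>s\<in>S. measure \<nu> (cylinder L s) * h s) = integral\<^sup>L \<nu> h"
    if "\<And>y y'. y' \<in> cylinder L y \<Longrightarrow> h y' = h y" for h
  proof -
    have "integral\<^sup>L \<nu> h = (\<integral>y. (\<Sum>s\<in>S. indicator (cylinder L s) y * h s) \<partial>\<nu>)"
      unfolding S_def by (subst sum_cylinder_words[OF that]) auto
    also have "\<dots> = (\<Sum>s\<in>S. measure \<nu> (cylinder L s) * h s)"
      using cyl by (subst Bochner_Integration.integral_sum) (auto simp: \<nu>.emeasure_eq_measure)
    finally show ?thesis by simp
  qed
  have "(\<Sum>s\<in>S. measure \<nu> (cylinder L s)) \<le> 1"
    using word_sum[of "\<lambda>_. 1"] \<nu>.prob_space by simp
  then obtain u :: "nat \<Rightarrow> nat \<Rightarrow> 'd" where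
    u: "\<And>h :: (nat \<Rightarrow> 'd) \<Rightarrow> real. (\<And>s. 0 \<le> h s) \<Longrightarrow>
      real m * (\<Sum>s\<in>S. measure \<nu> (cylinder L s) * h s) - sum h S \<le> (\<Sum>i<m. h (u i))"
    using quantization[OF fin, of "\<lambda>s. measure \<nu> (cylinder L s)" m] by auto
  text \<open>Positions beyond \<open>m * L\<close> in a period are filled with junk, as only lower bounds on
    frequencies are needed.\<close>
  define z where "z i = u ((i mod n) div L) ((i mod n) mod L)" for i
  have z: "z (a * L + b) = u a b" if "a < m" "b < L" for a b
  proof -
    have "a * L + b < Suc a * L" using that by simp
    also have "\<dots> \<le> m * L" using that by (intro mult_le_mono1) simp
    also have "\<dots> \<le> n" by (simp add: m_def)
    finally have "(a * L + b) mod n = a * L + b" by simp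
    then show ?thesis
      using that by (simp add: z_def)
  qed
  have "real m * real (L - k) * measure \<nu> (cylinder k w) - real (CARD('d) ^ L) * real L \<le>
    (\<Sum>i<n. indicator (cylinder k w) ((seq_shift ^^ i) z))" for w
  proof -
    let ?I = "\<lambda>y i. indicat_real (cylinder k w) ((seq_shift ^^ i) y)"
    \<comment> \<open>Starts below \<open>L - k\<close> keep the window of \<open>k\<close> letters
      inside the block, so \<open>h\<close> depends on the first \<open>L\<close> letters only. The
      \<open>k\<close> last starts of each block are given up.\<close>
    define h where "h y = (\<Sum>j<L - k. ?I y j)" for y
    have I_cong: "?I y i = ?I y' j" if "\<And>t. t < k \<Longrightarrow> y (i + t) = y' (j + t)" for y y' i j
      using that by (auto simp: indicator_def cylinder_def funpow_seq_shift add.commute)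
    have h_cong: "h y' = h y" if "y' \<in> cylinder L y" for y y'
      unfolding h_def
    proof (intro sum.cong refl I_cong)
      fix j t assume "j \<in> {..<L - k}" "t < k"
      then show "y' (j + t) = y (j + t)"
        using that by (auto simp: cylinder_def)
    qed
    have h0: "0 \<le> h y" for y by (simp add: h_def sum_nonneg)
    have hL: "h y \<le> L" for y
    proof -
      have "h y \<le> (\<Sum>j<L - k. 1)"
        unfolding h_def by (intro sum_mono) (auto simp: indicator_def)
      then show ?thesis by simp
    qed
    have pre: "{y. (seq_shift ^^ j) y \<in> cylinder k w} \<in> sets \<nu>" for j
      using measurable_sets[OF measurable_funpow_seq_shift sets_cylinder[of k w]]
      by (simp add: sets vimage_def)
    have "h = (\<lambda>y. \<Sum>j<L - k. indicator {y. (seq_shift ^^ j) y \<in> cylinder k w} y)"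
      unfolding h_def by (intro ext sum.cong refl) (simp add: indicator_def)
    then have "integral\<^sup>L \<nu> h =
        (\<integral>y. (\<Sum>j<L - k. indicator {y. (seq_shift ^^ j) y \<in> cylinder k w} y) \<partial>\<nu>)"
      by (rule arg_cong)
    also have "\<dots> = (\<Sum>j<L - k. measure \<nu> {y. (seq_shift ^^ j) y \<in> cylinder k w})"
      using pre by (subst Bochner_Integration.integral_sum) (auto simp: \<nu>.emeasure_eq_measure)
    also have "\<dots> = real (L - k) * measure \<nu> (cylinder k w)"
      by (simp add: measure_shift_preimage[OF \<nu> sets_cylinder])
    finally have int_h: "integral\<^sup>L \<nu> h = real (L - k) * measure \<nu> (cylinder k w)" .
    \<comment> \<open>The rounding error: up to one lost block for each of the
      \<open>CARD('d) ^ L\<close> words, each worth at most \<open>L\<close> visits.\<close>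
    have "sum h S \<le> real (card S) * real L"
      using sum_bounded_above[of S h "real L"] hL by simp
    moreover have "card S = CARD('d) ^ L"
      by (simp add: S_def card_PiE)
    ultimately have "real m * real (L - k) * measure \<nu> (cylinder k w) - real (CARD('d) ^ L) * real L
        \<le> real m * integral\<^sup>L \<nu> h - sum h S"
      by (simp add: int_h)
    also have "\<dots> \<le> (\<Sum>a<m. h (u a))"
      using u[of h] h0 word_sum[of h] h_cong by auto
    also have "\<dots> \<le> (\<Sum>a<m. \<Sum>i\<in>{a * L..<a * L + L}. ?I z i)"
    proof (intro sum_mono)
      fix a assume "a \<in> {..<m}"
      then have "h (u a) = (\<Sum>j<L - k. ?I z (j + a * L))"
        unfolding h_def
      proof (intro sum.cong refl I_cong)
        fix j t assume "j \<in> {..<L - k}" "t < k"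
        then show "u a (j + t) = z (j + a * L + t)"
          using z[of a "j + t"] \<open>a \<in> {..<m}\<close> by (simp add: algebra_simps)
      qed
      also have "\<dots> \<le> (\<Sum>j<L. ?I z (j + a * L))"
        by (intro sum_mono2) auto
      also have "\<dots> = (\<Sum>i\<in>{a * L..<a * L + L}. ?I z i)"
        using sum.shift_bounds_nat_ivl[of "?I z" 0 "a * L" L]
        by (simp add: lessThan_atLeast0 add.commute)
      finally show "h (u a) \<le> (\<Sum>i\<in>{a * L..<a * L + L}. ?I z i)" .
    qed
    also have "\<dots> = (\<Sum>i<m * L. ?I z i)"
      by (rule sum.nat_group)
    also have "\<dots> \<le> (\<Sum>i<n. ?I z i)"
      by (intro sum_mono2) (auto simp: m_def intro: order.strict_trans2[OF _ div_times_less_eq_dividend])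
    finally show ?thesis .
  qed
  moreover have "(seq_shift ^^ n) z = z"
    by (simp add: funpow_seq_shift z_def fun_eq_iff)
  ultimately show ?thesis unfolding m_def by blast
qed

lemma periodic_approximation:
  fixes \<nu> :: "(nat \<Rightarrow> 'd::{finite,discrete_topology}) measure"
  assumes \<nu>: "shift_invariant \<nu>" and e: "e > 0"
  shows "\<forall>\<^sub>F n in sequentially. \<exists>z. (seq_shift ^^ n) z = z \<and> (\<forall>w.
    measure \<nu> (cylinder k w) - e \<le>
    (\<Sum>i<n. indicator (cylinder k w) ((seq_shift ^^ i) z)) / real n)"
proof -
  interpret \<nu>: prob_space \<nu>
    using \<nu> by (auto simp: shift_invariant_def space_prob_algebra)
  \<comment> \<open>The block length is chosen first, so that the \<open>k\<close> starts lost per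
    block are at most the fraction \<open>e / 2\<close>.\<close>
  obtain L0 where L0: "real k < real L0 * (e / 2)"
    using reals_Archimedean3[of "e / 2"] e by auto
  define L where "L = L0 + k + 1"
  have L: "k \<le> L" "L \<ge> 1" "real k \<le> real L * (e / 2)"
  proof -
    have "real L0 * (e / 2) \<le> real L * (e / 2)"
      using e by (intro mult_right_mono) (auto simp: L_def)
    then show "real k \<le> real L * (e / 2)" using L0 by linarith
  qed (auto simp: L_def)
  \<comment> \<open>With \<open>L\<close> fixed, the period is made long enough for
    \<open>e / 2\<close> to absorb both the incomplete last block (at most \<open>L\<close>
    positions) and the rounding error \<open>CARD('d) ^ L * L\<close>.\<close>
  obtain n0 where n0: "real L * (1 + real (CARD('d) ^ L)) < real n0 * (e / 2)"
    using reals_Archimedean3[of "e / 2"] e by auto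
  show ?thesis
  proof (rule eventually_sequentiallyI[of "n0 + 1"])
    fix n assume "n \<ge> n0 + 1"
    then have n: "n \<ge> 1" "real n0 \<le> real n" by auto
    define m where "m = n div L"
    obtain z where z: "(seq_shift ^^ n) z = z" "\<And>w.
        real m * real (L - k) * measure \<nu> (cylinder k w) - real (CARD('d) ^ L) * real L \<le>
        (\<Sum>i<n. indicator (cylinder k w) ((seq_shift ^^ i) z))"
      using periodic_block_approximation[OF \<nu> L(1,2) n(1)] unfolding m_def by blast
    have "real m * real L + real (n mod L) = real n"
      by (simp add: m_def flip: of_nat_mult of_nat_add)
    moreover have "n mod L < L" using L(2) by simp
    ultimately have mL: "real n - real L \<le> real m * real L" "real m * real L \<le> real n"
      by linarith+
    have "(measure \<nu> (cylinder k w) - e) * real n \<le>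
        (\<Sum>i<n. indicator (cylinder k w) ((seq_shift ^^ i) z))" for w
    proof -
      let ?p = "measure \<nu> (cylinder k w)"
      have "real m * real k \<le> real m * (real L * (e / 2))"
        using L(3) by (intro mult_left_mono) auto
      also have "\<dots> \<le> real n * (e / 2)"
        using mL(2) e by (subst mult.assoc[symmetric]) (intro mult_right_mono, auto)
      finally have "real n - real L - real n * (e / 2) \<le> real m * real (L - k)"
        using mL(1) L(1) by (simp add: of_nat_diff algebra_simps)
      then have "(real n - (real L + real n * (e / 2))) * ?p \<le> real m * real (L - k) * ?p"
        by (intro mult_right_mono) auto
      moreover have "(real L + real n * (e / 2)) * ?p \<le> real L + real n * (e / 2)"
        using e by (intro mult_left_le) auto
      moreover have "real L * (1 + real (CARD('d) ^ L)) \<le> real n * (e / 2)"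
        using n0 n(2) e mult_right_mono[of "real n0" "real n" "e / 2"] by linarith
      ultimately show ?thesis
        using z(2)[of w] by (simp add: algebra_simps)
    qed
    then show "\<exists>z. (seq_shift ^^ n) z = z \<and> (\<forall>w. measure \<nu> (cylinder k w) - e \<le>
        (\<Sum>i<n. indicator (cylinder k w) ((seq_shift ^^ i) z)) / real n)"
      using z(1) n(1) by (intro exI[of _ z]) (simp add: pos_le_divide_eq)
  qed
qed

subsection \<open>Couplings\<close>

text \<open>Extends a coupling of the finite-valued observable \<open>U\<close> with an index to a
  coupling of all of \<open>M\<close> with that index: given \<open>U x = s\<close>, the index is
  drawn independently of the rest of \<open>x\<close>. As \<open>U\<close> has finitely many values,
  this conditioning is an explicit density.\<close>

lemma finite_coupling:
  fixes T :: "'s \<Rightarrow> 'i \<Rightarrow> real"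
  assumes "prob_space M" and fin: "finite S" "finite I" and U: "U \<in> M \<rightarrow>\<^sub>M count_space S"
    and T: "\<And>s i. 0 \<le> T s i"
    and sum_T: "\<And>s. s \<in> S \<Longrightarrow> (\<Sum>i\<in>I. T s i) = measure M {x\<in>space M. U x = s}"
  obtains N where "prob_space N" "sets N = sets (count_space I \<Otimes>\<^sub>M M)" "distr N M snd = M"
    "\<And>s i. s \<in> S \<Longrightarrow> i \<in> I \<Longrightarrow> measure N ({i} \<times> {x\<in>space M. U x = s}) = T s i"
proof -
  interpret M: prob_space M by fact
  define A where "A s = {x\<in>space M. U x = s}" for s
  define p where "p s = measure M (A s)" for s
  define w where "w s i = ennreal (T s i / p s)" for s i
  text \<open>The density of \<open>i\<close> given \<open>U x = s\<close> is \<open>T s i / p s\<close>; on the null sets \<open>p s = 0\<close> the value is irrelevant.\<close>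
  define h where "h = (\<lambda>(i, x). \<Sum>s\<in>S. w s i * indicator (A s) x)"
  define N where "N = density (count_space I \<Otimes>\<^sub>M M) h"
  have A[measurable]: "A s \<in> sets M" if "s \<in> S" for s
    using measurable_sets[OF U, of "{s}"] that by (simp add: A_def vimage_def Int_def conj_commute)
  have US: "U x \<in> S" if "x \<in> space M" for x
    using measurable_space[OF U that] by simp
  have h[measurable]: "h \<in> borel_measurable (count_space I \<Otimes>\<^sub>M M)"
  proof (rule measurable_pair_measure_countable1)
    show "(\<lambda>x. h (i, x)) \<in> borel_measurable M" for i
      unfolding h_def prod.case by measurable
  qed (use fin in \<open>simp add: countable_finite\<close>)
  have T_p: "T s i = p s * (T s i / p s)" if "s \<in> S" "i \<in> I" for s i
  proof (cases "p s = 0")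
    case True
    then have "T s i = 0"
      using sum_T[OF that(1)] that fin T by (simp add: p_def A_def sum_nonneg_eq_0_iff)
    then show ?thesis by simp
  qed simp
  \<comment> \<open>The weights sum to 1 only if \<open>p s \<noteq> 0\<close>. For
    \<open>p s = 0\<close> they are all 0, and the identity survives because the set has measure
    0.\<close>
  have sum_w: "(\<Sum>i\<in>I. w s i) * emeasure M (A s \<inter> B) = emeasure M (A s \<inter> B)"
    if s: "s \<in> S" and B: "B \<in> sets M" for s B
  proof (cases "p s = 0")
    case True
    have "emeasure M (A s \<inter> B) \<le> emeasure M (A s)"
      using s by (intro emeasure_mono) auto
    also have "\<dots> = 0" using True by (simp add: M.emeasure_eq_measure p_def)
    finally show ?thesis by simp
  next
    case False
    have "(\<Sum>i\<in>I. w s i) = ennreal (\<Sum>i\<in>I. T s i / p s)"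
      unfolding w_def using T by (intro sum_ennreal) (simp add: p_def)
    also have "(\<Sum>i\<in>I. T s i / p s) = 1"
      using sum_T[OF s] False by (simp flip: sum_divide_distrib add: p_def A_def)
    finally show ?thesis by simp
  qed
  have setsN: "sets N = sets (count_space I \<Otimes>\<^sub>M M)" by (simp add: N_def)
  have emN: "emeasure N B = (\<Sum>i\<in>I. \<Sum>s\<in>S. w s i * emeasure M (A s \<inter> Pair i -` B))"
    if B[measurable]: "B \<in> sets (count_space I \<Otimes>\<^sub>M M)" for B
  proof -
    have AB: "A s \<inter> Pair i -` B \<in> sets M" if "s \<in> S" for s i
      using that by (intro sets.Int A sets_Pair1[OF B])
    have "emeasure N B = (\<integral>\<^sup>+ z. h z * indicator B z \<partial>(count_space I \<Otimes>\<^sub>M M))"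
      unfolding N_def by (rule emeasure_density[OF h B])
    also have "\<dots> = (\<integral>\<^sup>+ i. \<integral>\<^sup>+ x. h (i, x) * indicator B (i, x) \<partial>M \<partial>count_space I)"
      by (intro M.nn_integral_fst[symmetric]) simp
    also have "\<dots> = (\<Sum>i\<in>I. \<integral>\<^sup>+ x. h (i, x) * indicator B (i, x) \<partial>M)"
      by (rule nn_integral_count_space_finite[OF fin(2)])
    also have "\<dots> = (\<Sum>i\<in>I. \<Sum>s\<in>S. w s i * emeasure M (A s \<inter> Pair i -` B))"
    proof (intro sum.cong refl)
      fix i assume "i \<in> I"
      have "(\<integral>\<^sup>+ x. h (i, x) * indicator B (i, x) \<partial>M) =
          (\<integral>\<^sup>+ x. (\<Sum>s\<in>S. w s i * indicator (A s \<inter> Pair i -` B) x) \<partial>M)"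
        by (intro nn_integral_cong)
          (auto simp: h_def sum_distrib_right indicator_def intro!: sum.cong)
      also have "\<dots> = (\<Sum>s\<in>S. w s i * emeasure M (A s \<inter> Pair i -` B))"
        by (subst nn_integral_sum)
          (auto intro!: sum.cong nn_integral_cmult_indicator borel_measurable_times_ennreal
            borel_measurable_indicator AB)
      finally show "(\<integral>\<^sup>+ x. h (i, x) * indicator B (i, x) \<partial>M) = \<dots>" .
    qed
    finally show ?thesis .
  qed
  have dist: "distr N M snd = M"
  proof (rule measure_eqI)
    fix B assume "B \<in> sets (distr N M snd)"
    then have B[measurable]: "B \<in> sets M" by simp
    have "emeasure (distr N M snd) B = emeasure N (I \<times> B)"
      using sets.sets_into_space[OF B] sets_eq_imp_space_eq[OF setsN]
      by (subst emeasure_distr)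
        (auto simp: measurable_cong_sets[OF setsN refl] space_pair_measure intro!: arg_cong[of _ _ "emeasure N"])
    also have "\<dots> = (\<Sum>i\<in>I. \<Sum>s\<in>S. w s i * emeasure M (A s \<inter> B))"
      by (subst emN) (auto intro!: sum.cong arg_cong[of _ _ "emeasure M"])
    also have "\<dots> = (\<Sum>s\<in>S. (\<Sum>i\<in>I. w s i) * emeasure M (A s \<inter> B))"
      by (subst sum.swap) (simp add: sum_distrib_right)
    also have "\<dots> = (\<Sum>s\<in>S. emeasure M (A s \<inter> B))"
      by (intro sum.cong refl sum_w) auto
    also have "\<dots> = emeasure M (\<Union>s\<in>S. A s \<inter> B)"
    proof (rule sum_emeasure)
      show "disjoint_family_on (\<lambda>s. A s \<inter> B) S"
        by (auto simp: disjoint_family_on_def A_def)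
    qed (use fin A B in auto)
    also have "(\<Union>s\<in>S. A s \<inter> B) = B"
      using sets.sets_into_space[OF B] US by (auto simp: A_def)
    finally show "emeasure (distr N M snd) B = emeasure M B" .
  qed simp
  show ?thesis
  proof (rule that[OF _ setsN dist])
    have "prob_space (distr N M snd)" by (simp add: dist M.prob_space_axioms)
    then show "prob_space N"
      by (rule prob_space_distrD[rotated]) (simp add: measurable_cong_sets[OF setsN refl])
    fix s i assume s: "s \<in> S" and i: "i \<in> I"
    have "emeasure N ({i} \<times> A s) =
        (\<Sum>j\<in>I. \<Sum>t\<in>S. w t j * emeasure M (A t \<inter> Pair j -` ({i} \<times> A s)))"
      using s i by (intro emN) auto
    also have "\<dots> = (\<Sum>j\<in>I. \<Sum>t\<in>S. if t = s then if j = i then w s i * emeasure M (A s) else 0 else 0)"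
    proof (intro sum.cong refl)
      fix j t
      have "A t \<inter> Pair j -` ({i} \<times> A s) = (if t = s \<and> j = i then A s else {})"
        by (auto simp: A_def)
      then show "w t j * emeasure M (A t \<inter> Pair j -` ({i} \<times> A s)) =
          (if t = s then if j = i then w s i * emeasure M (A s) else 0 else 0)" by simp
    qed
    also have "\<dots> = ennreal (T s i / p s) * ennreal (p s)"
      using s i fin by (simp add: w_def M.emeasure_eq_measure p_def)
    also have "\<dots> = ennreal (T s i)"
      using T_p[OF s i] T by (simp flip: ennreal_mult' add: p_def mult.commute)
    finally show "measure N ({i} \<times> {x\<in>space M. U x = s}) = T s i"
      using T by (simp add: measure_def A_def)
  qed
qed

text \<open>The second marginal is the uniform law on the indices, not the law of their words, since
  an index must later select a point of the orbit. The kept mass is the sum of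
  \<open>min (p s) (q s)\<close>, hence at least the sum of \<open>p s - e\<close>.\<close>

lemma maximal_coupling:
  fixes p :: "'s \<Rightarrow> real" and V :: "'i \<Rightarrow> 's"
  assumes fin: "finite S" "finite I" and I: "I \<noteq> {}" and V: "V ` I \<subseteq> S"
    and p: "\<And>s. s \<in> S \<Longrightarrow> 0 \<le> p s" "sum p S = 1"
    and pq: "\<And>s. s \<in> S \<Longrightarrow> p s - e \<le> real (card {i\<in>I. V i = s}) / real (card I)"
    and "e \<ge> 0"
  obtains T where "\<And>s i. 0 \<le> T s i" "\<And>s. s \<in> S \<Longrightarrow> (\<Sum>i\<in>I. T s i) = p s"
    "\<And>i. i \<in> I \<Longrightarrow> (\<Sum>s\<in>S. T s i) = 1 / real (card I)"
    "1 - real (card S) * e \<le> (\<Sum>i\<in>I. T (V i) i)"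
proof -
  define n where "n = real (card I)"
  define q where "q s = real (card {i\<in>I. V i = s}) / n" for s
  define m where "m s = min (p s) (q s)" for s
  \<comment> \<open>The kept mass \<open>m s\<close> is shared equally among the
    \<open>n * q s\<close> indices whose word is \<open>s\<close>.\<close>
  define r where "r i = m (V i) / (n * q (V i))" for i
  define R where "R = 1 - sum m S"
  text \<open>The mass \<open>min (p s) (q s)\<close> stays at \<open>s\<close>, the excess of \<open>p\<close> is spread over the deficit of \<open>q\<close>.
    For \<open>R = 0\<close> the quotient is \<open>0\<close>, as it should be, since then \<open>p = q\<close>.\<close>
  define T where "T s i = (if s \<in> S \<and> i \<in> I then
    (if V i = s then r i else 0) + (p s - m s) * (1 / n - r i) / R else 0)" for s i
  have n: "n > 0" using fin I by (simp add: n_def card_gt_0_iff)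
  have nq: "n * q s = card {i\<in>I. V i = s}" for s
    using n by (simp add: q_def)
  have q0: "q s \<ge> 0" for s using n by (simp add: q_def)
  have m: "0 \<le> m s" "m s \<le> p s" "m s \<le> q s" if "s \<in> S" for s
    using p(1)[OF that] q0[of s] by (auto simp: m_def)
  have qpos: "q (V i) > 0" if "i \<in> I" for i
  proof -
    have "n * q (V i) > 0"
      using that fin unfolding nq by (auto simp: card_gt_0_iff)
    then show ?thesis using n by (simp add: zero_less_mult_iff)
  qed
  have r: "0 \<le> r i" "r i \<le> 1 / n" if "i \<in> I" for i
    using m[of "V i"] V that qpos[OF that] n by (auto simp: r_def field_simps)
  have sum_r: "(\<Sum>i\<in>{i\<in>I. V i = s}. r i) = m s" if "s \<in> S" for s
  proof -
    have "(\<Sum>i\<in>{i\<in>I. V i = s}. r i) = (n * q s) * (m s / (n * q s))"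
      unfolding nq by (simp add: r_def nq)
    also have "\<dots> = m s"
      using m[OF that] n by (cases "q s = 0") auto
    finally show ?thesis .
  qed
  have sum_r_I: "sum r I = sum m S"
    using sum.group[OF fin(2,1) V, of r] sum_r by simp
  have sum_q: "sum q S = 1"
  proof -
    have "(\<Sum>s\<in>S. n * q s) = n"
      using sum.group[OF fin(2,1) V, of "\<lambda>_. 1 :: real"] by (simp add: nq) (simp add: n_def)
    then show ?thesis using n by (simp flip: sum_distrib_left)
  qed
  have R0: "R \<ge> 0" using sum_mono[of S m p] m p by (auto simp: R_def)
  \<comment> \<open>The moved mass is at once the excess of \<open>p\<close>, the deficit of
    \<open>q\<close>, and the part of the uniform law on indices not yet used by
    \<open>r\<close>.\<close>
  have R_eq: "R = (\<Sum>s\<in>S. p s - m s)" "R = (\<Sum>s\<in>S. q s - m s)" "R = (\<Sum>i\<in>I. 1 / n - r i)"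
    using n by (simp_all add: R_def sum_subtractf p sum_q sum_r_I n_def)
  have Rp: "(p s - m s) * R / R = p s - m s" if "s \<in> S" for s
  proof (cases "R = 0")
    case True
    then have "p s - m s = 0"
      using R_eq(1) sum_nonneg_eq_0_iff[of S "\<lambda>s. p s - m s"] fin m that by auto
    then show ?thesis by simp
  qed simp
  have Rr: "R * (1 / n - r i) / R = 1 / n - r i" if "i \<in> I" for i
  proof (cases "R = 0")
    case True
    then have "1 / n - r i = 0"
      using R_eq(3) sum_nonneg_eq_0_iff[of I "\<lambda>i. 1 / n - r i"] fin r that by auto
    then show ?thesis by simp
  qed simp
  show ?thesis
  proof (rule that)
    show T0: "0 \<le> T s i" for s i
      using m[of s] r[of i] R0 by (auto simp: T_def intro!: add_nonneg_nonneg divide_nonneg_nonneg mult_nonneg_nonneg)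
    show "(\<Sum>i\<in>I. T s i) = p s" if "s \<in> S" for s
    proof -
      have "(\<Sum>i\<in>I. T s i) = (\<Sum>i\<in>I. if V i = s then r i else 0) + (p s - m s) * R / R"
        using that by (simp add: T_def sum.distrib R_eq(3) sum_distrib_left flip: sum_divide_distrib)
      also have "(\<Sum>i\<in>I. if V i = s then r i else 0) = m s"
        using sum_r[OF that] fin by (simp add: sum.inter_filter)
      finally show ?thesis using Rp[OF that] by simp
    qed
    show "(\<Sum>s\<in>S. T s i) = 1 / real (card I)" if i: "i \<in> I" for i
    proof -
      have "(\<Sum>s\<in>S. T s i) = (\<Sum>s\<in>S. if V i = s then r i else 0) + R * (1 / n - r i) / R"
        using that by (simp add: T_def sum.distrib R_eq(1) sum_distrib_right flip: sum_divide_distrib)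
      also have "(\<Sum>s\<in>S. if V i = s then r i else 0) = r i"
        using V i fin by auto
      finally show ?thesis using Rr[OF i] by (simp add: n_def)
    qed
    have "1 - real (card S) * e = (\<Sum>s\<in>S. p s - e)"
      by (simp add: sum_subtractf p)
    also have "\<dots> \<le> sum m S"
      using pq \<open>e \<ge> 0\<close> by (intro sum_mono) (auto simp: m_def q_def n_def)
    also have "\<dots> = sum r I" by (simp add: sum_r_I)
    also have "\<dots> \<le> (\<Sum>i\<in>I. T (V i) i)"
    proof (intro sum_mono)
      fix i assume i: "i \<in> I"
      then have "(p (V i) - m (V i)) * (1 / n - r i) / R \<ge> 0"
        using m[of "V i"] r[of i] R0 V by (intro divide_nonneg_nonneg mult_nonneg_nonneg) auto
      then show "r i \<le> T (V i) i" using V i by (auto simp: T_def)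
    qed
    finally show "1 - real (card S) * e \<le> (\<Sum>i\<in>I. T (V i) i)" .
  qed
qed

subsection \<open>Plans with periodic marginals and weak limits\<close>

text \<open>The new plan is the law of \<open>(x, (seq_shift ^^ i) z)\<close>, where the index
  \<open>i\<close> is coupled to \<open>(x, y)\<close>. If the words of length \<open>k\<close>
  agree, \<open>c\<close> changes by at most \<delta>; otherwise, with probability at most
  \<open>CARD('d) ^ k * e\<close>, it changes by at most \<open>2 * B\<close>.\<close>

lemma exists_plan_near:
  fixes c :: "'x::topological_space \<times> (nat \<Rightarrow> 'd::{finite,discrete_topology}) \<Rightarrow> real"
  assumes \<pi>: "\<pi> \<in> space (prob_algebra borel)" and n: "n \<ge> 1"
    and c: "continuous_on UNIV c" and B: "\<And>p. \<bar>c p\<bar> \<le> B"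
    and osc: "\<And>x y y'. y' \<in> cylinder k y \<Longrightarrow> \<bar>c (x, y') - c (x, y)\<bar> \<le> \<delta>"
    and freq: "\<And>w. measure (distr \<pi> borel snd) (cylinder k w) - e \<le>
      (\<Sum>i<n. indicator (cylinder k w) ((seq_shift ^^ i) z)) / real n"
    and e: "e \<ge> 0"
  shows "\<exists>\<pi>'\<in>plans (distr \<pi> borel fst) (orbit_measure n z).
    integral\<^sup>L \<pi> c - \<delta> - 2 * B * (real (CARD('d) ^ k) * e) \<le> integral\<^sup>L \<pi>' c"
proof -
  have "prob_space \<pi>" and sets: "sets \<pi> = sets borel"
    using \<pi> by (auto simp: space_prob_algebra)
  then interpret \<pi>: prob_space \<pi> by simp
  have sp: "space \<pi> = UNIV" using sets by (auto dest: sets_eq_imp_space_eq)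
  have cont_meas: "f \<in> \<pi> \<rightarrow>\<^sub>M borel" if "continuous_on UNIV f" for f :: "_ \<Rightarrow> 'b::topological_space"
    using borel_measurable_continuous_onI[OF that] measurable_cong_sets[OF sets refl] by blast
  have fst_m: "fst \<in> \<pi> \<rightarrow>\<^sub>M borel" and snd_m: "snd \<in> \<pi> \<rightarrow>\<^sub>M borel" and c_m: "c \<in> borel_measurable \<pi>"
    by (auto intro!: cont_meas c continuous_on_fst continuous_on_snd continuous_on_id)
  define S where "S = PiE {..<k} (\<lambda>_. UNIV :: 'd set)"
  define I where "I = {..<n}"
  define U where "U p = restrict (snd p) {..<k}" for p :: "'x \<times> (nat \<Rightarrow> 'd)"
  define V where "V i = restrict ((seq_shift ^^ i) z) {..<k}" for i
  define p where "p s = measure \<pi> {x\<in>space \<pi>. U x = s}" for s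
  have fin: "finite S" "finite I" "I \<noteq> {}" "card I = n" "card S = CARD('d) ^ k"
    using n by (auto simp: S_def I_def finite_words card_PiE lessThan_empty_iff)
  have US: "U x \<in> S" for x by (simp add: U_def S_def)
  have VS: "V ` I \<subseteq> S" unfolding V_def S_def by (intro image_subsetI restrict_PiE_iff[THEN iffD2]) auto
  have U_eq: "{x\<in>space \<pi>. U x = s} = snd -` cylinder k s \<inter> space \<pi>" if "s \<in> S" for s
    using cylinder_word_iff[of s k] that by (auto simp: U_def S_def)
  have A: "{x\<in>space \<pi>. U x = s} \<in> sets \<pi>" if "s \<in> S" for s
    unfolding U_eq[OF that] by (rule measurable_sets[OF snd_m sets_cylinder])
  have U: "U \<in> \<pi> \<rightarrow>\<^sub>M count_space S"
    using A US fin by (subst measurable_count_space_eq2) (auto simp: vimage_def Int_def conj_commute)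
  have p_cyl: "p s = measure (distr \<pi> borel snd) (cylinder k s)" if "s \<in> S" for s
    unfolding p_def U_eq[OF that] by (rule measure_distr[OF snd_m sets_cylinder, symmetric])
  have "sum p S = measure \<pi> (\<Union>s\<in>S. {x\<in>space \<pi>. U x = s})"
    unfolding p_def using A fin
    by (intro \<pi>.finite_measure_finite_Union[symmetric]) (auto simp: disjoint_family_on_def)
  also have "(\<Union>s\<in>S. {x\<in>space \<pi>. U x = s}) = space \<pi>" using US by auto
  finally have sum_p: "sum p S = 1" by (simp add: \<pi>.prob_space)
  have pq: "p s - e \<le> real (card {i\<in>I. V i = s}) / real (card I)" if "s \<in> S" for s
  proof -
    have "(\<Sum>i<n. indicat_real (cylinder k s) ((seq_shift ^^ i) z)) =
        (\<Sum>i\<in>I. if V i = s then 1 else 0)"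
      using cylinder_word_iff[of s k] that
      by (intro sum.cong) (auto simp: I_def V_def S_def indicator_def)
    also have "\<dots> = card {i\<in>I. V i = s}"
      using fin by (simp flip: sum.inter_filter)
    finally show ?thesis
      using freq[of s] p_cyl[OF that] fin by simp
  qed
  obtain T where T: "\<And>s i. 0 \<le> T s i" "\<And>s. s \<in> S \<Longrightarrow> (\<Sum>i\<in>I. T s i) = p s"
    "\<And>i. i \<in> I \<Longrightarrow> (\<Sum>s\<in>S. T s i) = 1 / real n"
    "1 - real (card S) * e \<le> (\<Sum>i\<in>I. T (V i) i)"
    using maximal_coupling[OF fin(1-3) VS _ sum_p pq e] fin(4) by (auto simp: p_def)
  obtain N where "prob_space N" and setsN: "sets N = sets (count_space I \<Otimes>\<^sub>M \<pi>)"
    and distN: "distr N \<pi> snd = \<pi>"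
    and N: "\<And>s i. s \<in> S \<Longrightarrow> i \<in> I \<Longrightarrow> measure N ({i} \<times> {x\<in>space \<pi>. U x = s}) = T s i"
    by (rule finite_coupling[where T = T, OF \<pi>.prob_space_axioms fin(1,2) U T(1)])
      (auto simp: T(2) p_def)
  interpret N: prob_space N by fact
  have spN: "space N = I \<times> UNIV"
    using sets_eq_imp_space_eq[OF setsN] by (simp add: space_pair_measure sp)
  have snd_N: "snd \<in> N \<rightarrow>\<^sub>M \<pi>"
    by (simp add: measurable_cong_sets[OF setsN refl])
  have cell: "{i} \<times> {x\<in>space \<pi>. U x = s} \<in> sets N" if "s \<in> S" "i \<in> I" for s i
    using that A by (auto simp: setsN)
  \<comment> \<open>Both the orbit marginal and the event that the words agree reduce to unions of
    cells, given by an index and a word, on which \<open>N\<close> is known from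
    \<open>T\<close>.\<close>
  have cells: "measure N (\<Union>(i, s)\<in>D. {i} \<times> {x\<in>space \<pi>. U x = s}) = (\<Sum>(i, s)\<in>D. T s i)"
    if "D \<subseteq> I \<times> S" for D
  proof -
    have "measure N (\<Union>d\<in>D. {fst d} \<times> {x\<in>space \<pi>. U x = snd d}) =
        (\<Sum>d\<in>D. measure N ({fst d} \<times> {x\<in>space \<pi>. U x = snd d}))"
      using that cell finite_subset[OF that] fin
      by (intro N.finite_measure_finite_Union) (auto simp: disjoint_family_on_def)
    also have "\<dots> = (\<Sum>d\<in>D. T (snd d) (fst d))"
      using that N by (intro sum.cong) auto
    finally show ?thesis by (simp add: case_prod_unfold)
  qed
  define g where "g = (\<lambda>(i, p :: 'x \<times> (nat \<Rightarrow> 'd)). (fst p, (seq_shift ^^ i) z))"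
  have g: "g \<in> N \<rightarrow>\<^sub>M borel"
    unfolding measurable_cong_sets[OF setsN refl]
  proof (rule measurable_pair_measure_countable1)
    show "(\<lambda>p. g (i, p)) \<in> \<pi> \<rightarrow>\<^sub>M borel" for i
      unfolding g_def prod.case by (intro cont_meas continuous_intros)
  qed (use fin in \<open>simp add: countable_finite\<close>)
  have fst_b: "fst \<in> borel \<rightarrow>\<^sub>M (borel :: 'x measure)" and
    snd_b: "snd \<in> borel \<rightarrow>\<^sub>M (borel :: (nat \<Rightarrow> 'd) measure)"
    by (intro borel_measurable_continuous_onI continuous_intros)+
  define \<pi>' where "\<pi>' = distr N borel g"
  have prob': "\<pi>' \<in> space (prob_algebra borel)"
    by (simp add: \<pi>'_def space_prob_algebra N.prob_space_distr[OF g])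
  have fst': "distr \<pi>' borel fst = distr \<pi> borel fst"
  proof -
    have "distr \<pi>' borel fst = distr N borel (fst \<circ> snd)"
      unfolding \<pi>'_def distr_distr[OF fst_b g]
      by (intro distr_cong) (auto simp: g_def)
    also have "\<dots> = distr (distr N \<pi> snd) borel fst"
      by (rule distr_distr[OF fst_m snd_N, symmetric])
    finally show ?thesis by (simp add: distN)
  qed
  have snd': "distr \<pi>' borel snd = orbit_measure n z"
  proof (rule measure_eqI)
    show "sets (distr \<pi>' borel snd) = sets (orbit_measure n z)"
      by (simp add: orbit_measure_def)
    fix C assume "C \<in> sets (distr \<pi>' borel snd)"
    then have C: "C \<in> sets borel" by simp
    define J where "J = {i\<in>I. (seq_shift ^^ i) z \<in> C}"
    have gC: "(snd \<circ> g) -` C \<inter> space N = (\<Union>(i, s)\<in>J \<times> S. {i} \<times> {x\<in>space \<pi>. U x = s})"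
      using US by (auto simp: g_def spN J_def sp)
    have "emeasure (distr \<pi>' borel snd) C = emeasure N ((snd \<circ> g) -` C \<inter> space N)"
      unfolding \<pi>'_def distr_distr[OF snd_b g]
      by (rule emeasure_distr[OF measurable_comp[OF g snd_b] C])
    also have "\<dots> = ennreal (\<Sum>(i, s)\<in>J \<times> S. T s i)"
      unfolding gC N.emeasure_eq_measure by (subst cells) (auto simp: J_def)
    also have "(\<Sum>(i, s)\<in>J \<times> S. T s i) = (\<Sum>i\<in>J. \<Sum>s\<in>S. T s i)"
      by (rule sum.cartesian_product[symmetric])
    also have "\<dots> = (\<Sum>i\<in>J. 1 / real n)"
      using T(3) by (intro sum.cong) (auto simp: J_def)
    also have "\<dots> = (\<Sum>i<n. indicator C ((seq_shift ^^ i) z)) / real n"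
      by (simp add: J_def I_def indicator_def sum.If_cases Int_def)
    finally show "emeasure (distr \<pi>' borel snd) C = emeasure (orbit_measure n z) C"
      using emeasure_orbit_measure[OF n C] by simp
  qed
  define G where "G = (\<Union>(i, s)\<in>(\<lambda>i. (i, V i)) ` I. {i} \<times> {x\<in>space \<pi>. U x = s})"
  have G: "G \<in> sets N"
    unfolding G_def using cell VS fin by (intro sets.finite_UN) auto
  have "measure N G = (\<Sum>i\<in>I. T (V i) i)"
    unfolding G_def using VS by (subst cells) (auto simp: sum.reindex inj_on_def)
  then have mG: "1 - real (CARD('d) ^ k) * e \<le> measure N G"
    using T(4) fin(5) by simp
  have B0: "B \<ge> 0" using B[of undefined] by linarith
  have \<delta>0: "\<delta> \<ge> 0" using osc[OF cylinder_self, of undefined] by simp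
  have c_borel: "c \<in> borel_measurable borel"
    using c by (rule borel_measurable_continuous_onI)
  have int_c: "integrable N (\<lambda>\<omega>. c (f \<omega>))" if "(\<lambda>\<omega>. c (f \<omega>)) \<in> borel_measurable N" for f
    using that by (rule N.integrable_const_bound[where B=B, rotated]) (rule AE_I2, simp only: real_norm_def B)
  have int: "integrable N (\<lambda>\<omega>. c (snd \<omega>))" "integrable N (\<lambda>\<omega>. c (g \<omega>))"
    by (rule int_c, rule measurable_compose[OF snd_N c_m])
      (rule int_c, rule measurable_compose[OF g c_borel])
  have int_G: "integrable N (indicat_real G)"
    using G by (simp add: N.emeasure_eq_measure)
  have "integral\<^sup>L \<pi> c - integral\<^sup>L \<pi>' c = (\<integral>\<omega>. c (snd \<omega>) - c (g \<omega>) \<partial>N)"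
  proof -
    have "integral\<^sup>L (distr N \<pi> snd) c = (\<integral>\<omega>. c (snd \<omega>) \<partial>N)"
      by (rule integral_distr[OF snd_N c_m])
    moreover have "integral\<^sup>L \<pi>' c = (\<integral>\<omega>. c (g \<omega>) \<partial>N)"
      unfolding \<pi>'_def by (rule integral_distr[OF g c_borel])
    ultimately show ?thesis using int by (simp add: distN)
  qed
  also have "\<dots> \<le> (\<integral>\<omega>. \<delta> + 2 * B * (1 - indicator G \<omega>) \<partial>N)"
  proof (rule integral_mono)
    fix \<omega> assume "\<omega> \<in> space N"
    then obtain i x y where \<omega>: "\<omega> = (i, x, y)" "i \<in> I" by (auto simp: spN)
    show "c (snd \<omega>) - c (g \<omega>) \<le> \<delta> + 2 * B * (1 - indicator G \<omega>)"
    proof (cases "\<omega> \<in> G")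
      case True
      then have eq: "restrict y {..<k} = restrict ((seq_shift ^^ i) z) {..<k}"
        by (auto simp: G_def \<omega> U_def V_def)
      have "(seq_shift ^^ i) z \<in> cylinder k y"
        unfolding cylinder_def
      proof (intro CollectI allI impI)
        show "(seq_shift ^^ i) z t = y t" if "t < k" for t
          using fun_cong[OF eq, of t] that by simp
      qed
      from osc[OF this, of x] True show ?thesis by (simp add: \<omega> g_def)
    next
      case False
      then show ?thesis
        using B[of "snd \<omega>"] B[of "g \<omega>"] \<delta>0 by simp
    qed
  qed (use int int_G in auto)
  also have "\<dots> = \<delta> + 2 * B * (1 - measure N G)"
    using int_G G by (simp add: N.prob_space)
  also have "\<dots> \<le> \<delta> + 2 * B * (real (CARD('d) ^ k) * e)"
    using mG B0 by (intro add_left_mono mult_left_mono) auto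
  finally show ?thesis
    using prob' fst' snd' by (intro bexI[of _ \<pi>']) (auto simp: plans_def)
qed

lemma eventually_Fix_plan_near:
  fixes c :: "'x::topological_space \<times> (nat \<Rightarrow> 'd::{finite,discrete_topology}) \<Rightarrow> real"
  assumes X: "compact (UNIV :: 'x set)" and c: "continuous_on UNIV c"
    and \<pi>: "\<pi> \<in> invariant_plans \<mu>" and "\<epsilon> > 0"
  shows "\<forall>\<^sub>F n in sequentially. \<exists>\<nu>\<in>Fix n. \<exists>\<pi>'\<in>plans \<mu> \<nu>. integral\<^sup>L \<pi> c - \<epsilon> \<le> integral\<^sup>L \<pi>' c"
proof -
  have \<pi>': "\<pi> \<in> space (prob_algebra borel)" "distr \<pi> borel fst = \<mu>" "shift_invariant (distr \<pi> borel snd)"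
    using \<pi> by (auto simp: invariant_plans_def)
  obtain k where k: "\<And>x y y'. y' \<in> cylinder k y \<Longrightarrow> \<bar>c (x, y') - c (x, y)\<bar> < \<epsilon> / 2"
    using uniformly_continuous_snd[OF X c, of "\<epsilon> / 2"] \<open>\<epsilon> > 0\<close> by auto
  obtain B where B: "\<And>p. \<bar>c p\<bar> \<le> B" "B > 0"
    using compact_imp_bounded[OF compact_continuous_image[OF c compact_UNIV_Times[OF X]]]
    by (auto simp: bounded_pos)
  define K where "K = real (CARD('d) ^ k)"
  have "K > 0" by (simp add: K_def)
  \<comment> \<open>Half of \<epsilon> pays for the oscillation of \<open>c\<close> on cylinders of
    length \<open>k\<close>, the other half for the moved mass; \<open>e\<close> can be chosen after
    \<open>k\<close> and thus after \<open>K\<close>.\<close>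
  define e where "e = \<epsilon> / (4 * B * K)"
  have e: "e > 0" "2 * B * (K * e) = \<epsilon> / 2"
    using \<open>\<epsilon> > 0\<close> B(2) \<open>K > 0\<close> by (auto simp: e_def)
  from periodic_approximation[OF \<pi>'(3) e(1), of k] eventually_ge_at_top[of 1] show ?thesis
  proof eventually_elim
    case (elim n)
    then obtain z where z: "(seq_shift ^^ n) z = z" "\<And>w. measure (distr \<pi> borel snd) (cylinder k w) - e \<le>
        (\<Sum>i<n. indicator (cylinder k w) ((seq_shift ^^ i) z)) / real n" by auto
    from exists_plan_near[OF \<pi>'(1) elim(2) c B(1) less_imp_le[OF k] z(2) less_imp_le[OF e(1)]]
    obtain \<rho> where "\<rho> \<in> plans \<mu> (orbit_measure n z)"
      "integral\<^sup>L \<pi> c - \<epsilon> / 2 - 2 * B * (K * e) \<le> integral\<^sup>L \<rho> c"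
      by (auto simp: \<pi>'(2) K_def)
    then show ?case
      using z(1) e(2) by (intro bexI[of _ "orbit_measure n z"] bexI[of _ \<rho>]) (auto simp: Fix_def)
  qed
qed

text \<open>Both marginal conditions are stated as identities between integrals of continuous
  functions, the form in which they survive a weak* limit.\<close>

lemma weak_star_limit_invariant_plan:
  fixes M :: "nat \<Rightarrow> ('x::metric_space \<times> (nat \<Rightarrow> 'd::{finite,discrete_topology})) measure"
  assumes \<mu>: "\<mu> \<in> space (prob_algebra borel)"
    and \<pi>: "finite_measure \<pi>" "sets \<pi> = sets borel" and lim: "weak_star_tendsto M \<pi>"
    and fst_int: "\<And>j f :: 'x \<Rightarrow> real. continuous_on UNIV f \<Longrightarrow> (\<integral>z. f (fst z) \<partial>M j) = integral\<^sup>L \<mu> f"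
    and snd_int: "\<And>j f :: (nat \<Rightarrow> 'd) \<Rightarrow> real. continuous_on UNIV f \<Longrightarrow> (\<integral>z. f (seq_shift (snd z)) \<partial>M j) = (\<integral>z. f (snd z) \<partial>M j)"
  shows "\<pi> \<in> invariant_plans \<mu>"
proof -
  have conv: "(\<lambda>j. integral\<^sup>L (M j) w) \<longlonglongrightarrow> integral\<^sup>L \<pi> w" if "continuous_on UNIV w" for w :: "_ \<Rightarrow> real"
    using lim that by (auto simp: weak_star_tendsto_def)
  interpret \<pi>: finite_measure \<pi> by fact
  have sp: "space \<pi> = UNIV" using \<pi>(2) by (auto dest: sets_eq_imp_space_eq)
  interpret \<mu>: prob_space \<mu> using \<mu> by (simp add: space_prob_algebra)
  have \<mu>_int: "(\<integral>z. f (fst z) \<partial>\<pi>) = integral\<^sup>L \<mu> f" if "continuous_on UNIV f" for f :: "'x \<Rightarrow> real"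
  proof -
    have "continuous_on UNIV (\<lambda>z :: 'x \<times> (nat \<Rightarrow> 'd). f (fst z))"
      by (intro continuous_on_compose2[OF that] continuous_intros) auto
    from conv[OF this] show ?thesis by (simp add: fst_int[OF that] LIMSEQ_const_iff)
  qed
  have inv_int: "(\<integral>z. f (seq_shift (snd z)) \<partial>\<pi>) = (\<integral>z. f (snd z) \<partial>\<pi>)"
    if f: "continuous_on UNIV f" for f :: "(nat \<Rightarrow> 'd) \<Rightarrow> real"
  proof -
    have cont: "continuous_on UNIV (\<lambda>z :: 'x \<times> (nat \<Rightarrow> 'd). f (snd z))"
      "continuous_on UNIV (\<lambda>z :: 'x \<times> (nat \<Rightarrow> 'd). f (seq_shift (snd z)))"
      by (intro continuous_on_compose2[OF f] continuous_on_compose2[OF continuous_on_seq_shift]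
          continuous_intros; simp)+
    from conv[OF cont(1)] conv[OF cont(2)] show ?thesis
      by (simp add: snd_int[OF f] LIMSEQ_unique)
  qed
  \<comment> \<open>Testing the first marginal against the constant 1 shows that the limit, given
    only as a finite measure, has total mass 1.\<close>
  have prob: "prob_space \<pi>"
    using \<mu>_int[of "\<lambda>_. 1"] \<mu>.prob_space sp
    by (intro prob_spaceI) (simp add: \<pi>.emeasure_eq_measure)
  then interpret prob_space \<pi> .
  have m: "f \<in> \<pi> \<rightarrow>\<^sub>M borel" if "continuous_on UNIV f" for f :: "_ \<Rightarrow> 'b::topological_space"
    using borel_measurable_continuous_onI[OF that] measurable_cong_sets[OF \<pi>(2) refl] by blast
  have fst_m: "fst \<in> \<pi> \<rightarrow>\<^sub>M borel" and snd_m: "snd \<in> \<pi> \<rightarrow>\<^sub>M borel"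
    by (intro m continuous_intros)+
  have prob_snd: "prob_space (distr \<pi> borel snd)" by (rule prob_space_distr[OF snd_m])
  have "distr \<pi> borel fst = \<mu>"
  proof (rule measure_eqI_continuous_metric)
    show "finite_measure (distr \<pi> borel fst)" by (rule prob_space.axioms(1)[OF prob_space_distr[OF fst_m]])
    show "sets \<mu> = sets borel" using \<mu> by (simp add: space_prob_algebra)
    show "integral\<^sup>L (distr \<pi> borel fst) f = integral\<^sup>L \<mu> f" if "continuous_on UNIV f" for f :: "'x \<Rightarrow> real"
      using that by (simp add: integral_distr_borel[OF \<pi>(2) continuous_on_fst[OF continuous_on_id]] \<mu>_int)
  qed (auto intro: \<mu>.finite_measure_axioms)
  moreover have "distr (distr \<pi> borel snd) borel seq_shift = distr \<pi> borel snd"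
  proof (rule measure_eqI_continuous_seq)
    interpret s: prob_space "distr \<pi> borel snd" by (rule prob_snd)
    show "finite_measure (distr \<pi> borel snd)" by (rule s.finite_measure_axioms)
    show "finite_measure (distr (distr \<pi> borel snd) borel seq_shift)"
      by (rule prob_space.axioms(1)[OF s.prob_space_distr]) (simp add: measurable_seq_shift)
    show "integral\<^sup>L (distr (distr \<pi> borel snd) borel seq_shift) f = integral\<^sup>L (distr \<pi> borel snd) f"
      if f: "continuous_on UNIV f" for f :: "(nat \<Rightarrow> 'd) \<Rightarrow> real"
    proof -
      have fs: "continuous_on UNIV (\<lambda>y. f (seq_shift y))"
        by (intro continuous_on_compose2[OF f continuous_on_seq_shift]) auto
      note snd_c = continuous_on_snd[OF continuous_on_id]
      show ?thesis
        by (simp add: integral_distr_borel[OF _ continuous_on_seq_shift f]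
            integral_distr_borel[OF \<pi>(2) snd_c f] integral_distr_borel[OF \<pi>(2) snd_c fs] inv_int[OF f])
    qed
  qed auto
  ultimately show ?thesis
    using prob prob_snd \<pi>(2) by (simp add: invariant_plans_def shift_invariant_def space_prob_algebra)
qed

section \<open>Integrals against the Gibbs mixtures\<close>

lemma integral_zeta_plans:
  fixes c :: "'x::topological_space \<times> (nat \<Rightarrow> 'd::{finite,discrete_topology}) \<Rightarrow> real"
    and w :: "'x \<times> (nat \<Rightarrow> 'd) \<Rightarrow> real"
  assumes "compact (UNIV :: 'x set)" "n \<ge> 1" "\<And>\<nu>. \<nu> \<in> Fix n \<Longrightarrow> P \<nu> \<in> plans \<mu> \<nu>"
    and "continuous_on UNIV w"
  shows "integral\<^sup>L (zeta c P \<beta> n) w =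
    (\<Sum>\<nu>\<in>Fix n. gibbs_weight c P \<beta> n \<nu> * integral\<^sup>L (P \<nu>) w) / (\<Sum>\<nu>\<in>Fix n. gibbs_weight c P \<beta> n \<nu>)"
  unfolding gibbs_weight_def
proof (rule integral_zeta)
  show "bounded (range w)"
    by (intro compact_imp_bounded compact_continuous_image assms compact_UNIV_Times)
qed (use assms in \<open>auto simp: plans_def\<close>)

lemma sum_gibbs_weight_pos:
  fixes c :: "'x::topological_space \<times> (nat \<Rightarrow> 'd::{finite,topological_space}) \<Rightarrow> real"
  shows "n \<ge> 1 \<Longrightarrow> (\<Sum>\<nu>\<in>Fix n. gibbs_weight c P \<beta> n \<nu>) > 0"
  by (rule sum_pos) (auto simp: finite_Fix Fix_nonempty gibbs_weight_def)

lemma integral_plans_marginals: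
  assumes "\<pi> \<in> plans \<mu> \<nu>"
  shows "continuous_on UNIV f \<Longrightarrow> (\<integral>z. f (fst z) \<partial>\<pi>) = (integral\<^sup>L \<mu> f :: real)"
    and "continuous_on UNIV g \<Longrightarrow> (\<integral>z. g (snd z) \<partial>\<pi>) = (integral\<^sup>L \<nu> g :: real)"
proof -
  have \<pi>: "sets \<pi> = sets borel" "distr \<pi> borel fst = \<mu>" "distr \<pi> borel snd = \<nu>"
    using assms by (auto simp: plans_def space_prob_algebra)
  show "(\<integral>z. f (fst z) \<partial>\<pi>) = integral\<^sup>L \<mu> f" if "continuous_on UNIV f"
    using integral_distr_borel[OF \<pi>(1) continuous_on_fst[OF continuous_on_id] that] \<pi> by simp
  show "(\<integral>z. g (snd z) \<partial>\<pi>) = integral\<^sup>L \<nu> g" if "continuous_on UNIV g"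
    using integral_distr_borel[OF \<pi>(1) continuous_on_snd[OF continuous_on_id] that] \<pi> by simp
qed

text \<open>The factor \<open>n\<close> in the exponent of the weights matches the growth
  \<open>n * ln d\<close> of the log-cardinality of \<open>Fix n\<close>, so \<open>n\<close>
  cancels on division by \<open>\<beta> * n\<close>.\<close>

lemma integral_zeta_ge:
  fixes c :: "'x::topological_space \<times> (nat \<Rightarrow> 'd::{finite,discrete_topology}) \<Rightarrow> real"
  assumes "compact (UNIV :: 'x set)" and n: "n \<ge> 1" and "\<And>\<nu>. \<nu> \<in> Fix n \<Longrightarrow> P \<nu> \<in> plans \<mu> \<nu>"
    and "continuous_on UNIV c" and \<beta>: "\<beta> > 0" and \<nu>: "\<nu> \<in> Fix n"
  shows "integral\<^sup>L (P \<nu>) c - ln (real CARD('d)) / \<beta> \<le> integral\<^sup>L (zeta c P \<beta> n) c"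
proof -
  define s where "s \<nu> = \<beta> * real n * integral\<^sup>L (P \<nu>) c" for \<nu>
  have bn: "\<beta> * real n > 0" using n \<beta> by simp
  have "card (Fix n :: (nat \<Rightarrow> 'd) measure set) > 0"
    using \<nu> finite_Fix[OF n] card_gt_0_iff by blast
  moreover have "real (card (Fix n :: (nat \<Rightarrow> 'd) measure set)) \<le> real CARD('d) ^ n"
    using card_Fix_le[OF n, where 'd = 'd] by (metis of_nat_le_iff of_nat_power)
  ultimately have "ln (real (card (Fix n :: (nat \<Rightarrow> 'd) measure set))) \<le> ln (real CARD('d) ^ n)"
    by (intro ln_mono) auto
  also have "\<dots> = real n * ln (real CARD('d))"
    by (simp add: ln_realpow)
  finally have "s \<nu> - real n * ln (real CARD('d)) \<le>
      (\<Sum>\<nu>\<in>Fix n. exp (s \<nu>) * s \<nu>) / (\<Sum>\<nu>\<in>Fix n. exp (s \<nu>))"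
    using gibbs_mean_ge[OF finite_Fix[OF n] \<nu>, of s] by linarith
  also have "\<dots> = \<beta> * real n * integral\<^sup>L (zeta c P \<beta> n) c"
    by (subst integral_zeta_plans[OF assms(1-4)])
      (auto simp: gibbs_weight_def s_def sum_distrib_left algebra_simps)
  finally have "\<beta> * real n * (integral\<^sup>L (P \<nu>) c - ln (real CARD('d)) / \<beta>) \<le>
      \<beta> * real n * integral\<^sup>L (zeta c P \<beta> n) c"
    using \<beta> by (simp add: s_def algebra_simps)
  then show ?thesis
    using bn by (simp only: mult_le_cancel_left_pos)
qed

theorem theorem11:
  fixes c :: "'x::metric_space \<times> (nat \<Rightarrow> 'd::{finite,discrete_topology}) \<Rightarrow> real"
    and \<mu> :: "'x measure"
    and P :: "(nat \<Rightarrow> 'd) measure \<Rightarrow> ('x \<times> (nat \<Rightarrow> 'd)) measure"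
    and \<beta> :: "nat \<Rightarrow> real" and n :: "nat \<Rightarrow> nat"
    and \<pi>inf :: "('x \<times> (nat \<Rightarrow> 'd)) measure"
  assumes "compact (UNIV :: 'x set)"
    and "\<mu> \<in> space (prob_algebra borel)"
    and "continuous_on UNIV c"
    and "\<And>k \<nu>. k \<ge> 1 \<Longrightarrow> \<nu> \<in> Fix k \<Longrightarrow> maximizing_plan c \<mu> \<nu> (P \<nu>)"
    and "\<And>j. \<beta> j > 0" and "\<And>j. n j \<ge> 1"
    and "filterlim \<beta> at_top sequentially" and "filterlim n at_top sequentially"
    and "finite_measure \<pi>inf" and "sets \<pi>inf = sets borel"
    and "weak_star_tendsto (\<lambda>j. zeta c P (\<beta> j) (n j)) \<pi>inf"
  shows "\<pi>inf \<in> invariant_plans \<mu> \<and>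
    ((\<forall>z. c z > 0) \<longrightarrow>
      (\<forall>\<pi>\<in>invariant_plans \<mu>. integral\<^sup>L \<pi> c \<le> integral\<^sup>L \<pi>inf c) \<and>
      integral\<^sup>L \<pi>inf c = (SUP \<pi>\<in>invariant_plans \<mu>. integral\<^sup>L \<pi> c))"
proof -
  note X = assms(1) and c = assms(3) and \<beta> = assms(5) and n = assms(6)
  let ?W = "\<lambda>j. gibbs_weight c P (\<beta> j) (n j)"
  have P: "P \<nu> \<in> plans \<mu> \<nu>" if "\<nu> \<in> Fix (n j)" for \<nu> j
    using assms(4)[OF n that] by (simp add: maximizing_plan_def)
  note zeta = integral_zeta_plans[OF X n P]
  have W: "(\<Sum>\<nu>\<in>Fix (n j). ?W j \<nu>) > 0" for j
    by (rule sum_gibbs_weight_pos[OF n])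
  have inv: "\<pi>inf \<in> invariant_plans \<mu>"
  proof (rule weak_star_limit_invariant_plan[OF assms(2,9-11)])
    fix j and f :: "'x \<Rightarrow> real" assume f: "continuous_on UNIV f"
    have "continuous_on UNIV (\<lambda>z :: 'x \<times> (nat \<Rightarrow> 'd). f (fst z))"
      by (intro continuous_on_compose2[OF f] continuous_intros) auto
    then show "(\<integral>z. f (fst z) \<partial>zeta c P (\<beta> j) (n j)) = integral\<^sup>L \<mu> f"
      using W[of j] by (simp add: zeta integral_plans_marginals(1)[OF P f] flip: sum_distrib_right)
  next
    fix j and f :: "(nat \<Rightarrow> 'd) \<Rightarrow> real" assume f: "continuous_on UNIV f"
    have fs: "continuous_on UNIV (\<lambda>y. f (seq_shift y))"
      by (intro continuous_on_compose2[OF f continuous_on_seq_shift]) auto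
    have "continuous_on UNIV (\<lambda>z :: 'x \<times> (nat \<Rightarrow> 'd). f (snd z))"
      "continuous_on UNIV (\<lambda>z :: 'x \<times> (nat \<Rightarrow> 'd). f (seq_shift (snd z)))"
      by (intro continuous_on_compose2[OF f] continuous_on_compose2[OF fs] continuous_intros; simp)+
    then show "(\<integral>z. f (seq_shift (snd z)) \<partial>zeta c P (\<beta> j) (n j)) =
        (\<integral>z. f (snd z) \<partial>zeta c P (\<beta> j) (n j))"
      by (simp add: zeta integral_plans_marginals(2)[OF P f] integral_plans_marginals(2)[OF P fs]
          integral_Fix_shift[OF n _ f])
  qed
  have max: "integral\<^sup>L \<pi> c \<le> integral\<^sup>L \<pi>inf c" if \<pi>: "\<pi> \<in> invariant_plans \<mu>" for \<pi>
  proof (rule field_le_epsilon)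
    fix \<epsilon> :: real assume "\<epsilon> > 0"
    \<comment> \<open>The two limits decouple: \<epsilon> is fixed while \<open>n j\<close> grows to
      provide a nearby periodic plan, and \<open>\<beta> j\<close> only has to make the Gibbs loss
      vanish.\<close>
    have "\<forall>\<^sub>F j in sequentially. \<exists>\<nu>\<in>Fix (n j). \<exists>\<pi>'\<in>plans \<mu> \<nu>. integral\<^sup>L \<pi> c - \<epsilon> \<le> integral\<^sup>L \<pi>' c"
      using eventually_Fix_plan_near[OF X c \<pi> \<open>\<epsilon> > 0\<close>] assms(8)
      by (rule eventually_compose_filterlim)
    then have "\<forall>\<^sub>F j in sequentially. integral\<^sup>L \<pi> c - \<epsilon> - ln (real CARD('d)) / \<beta> j \<le>
        integral\<^sup>L (zeta c P (\<beta> j) (n j)) c"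
    proof eventually_elim
      case (elim j)
      then obtain \<nu> \<pi>' where \<nu>: "\<nu> \<in> Fix (n j)" "\<pi>' \<in> plans \<mu> \<nu>" "integral\<^sup>L \<pi> c - \<epsilon> \<le> integral\<^sup>L \<pi>' c"
        by blast
      \<comment> \<open>Optimality of the chosen plan enters here: the constructed plan \<pi>' is
        replaced by \<open>P \<nu>\<close>, the one that occurs in \<open>zeta\<close>.\<close>
      then have "integral\<^sup>L \<pi> c - \<epsilon> \<le> integral\<^sup>L (P \<nu>) c"
        using assms(4)[OF n \<nu>(1)] by (force simp: maximizing_plan_def)
      with integral_zeta_ge[OF X n P c \<beta> \<nu>(1)] show ?case by (meson diff_right_mono order_trans)
    qed
    moreover have "(\<lambda>j. integral\<^sup>L (zeta c P (\<beta> j) (n j)) c) \<longlonglongrightarrow> integral\<^sup>L \<pi>inf c"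
      using assms(11) c by (simp add: weak_star_tendsto_def)
    moreover have "(\<lambda>j. integral\<^sup>L \<pi> c - \<epsilon> - ln (real CARD('d)) / \<beta> j) \<longlonglongrightarrow> integral\<^sup>L \<pi> c - \<epsilon> - 0"
      by (intro tendsto_diff tendsto_const real_tendsto_divide_at_top[OF tendsto_const assms(7)])
    ultimately have "integral\<^sup>L \<pi> c - \<epsilon> - 0 \<le> integral\<^sup>L \<pi>inf c"
      by (intro tendsto_le[OF sequentially_bot])
    then show "integral\<^sup>L \<pi> c \<le> integral\<^sup>L \<pi>inf c + \<epsilon>" by simp
  qed
  have "integral\<^sup>L \<pi>inf c = (SUP \<pi>\<in>invariant_plans \<mu>. integral\<^sup>L \<pi> c)"
    using inv max by (intro cSup_eq_maximum[symmetric]) auto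
  with inv max show ?thesis by blast
qed

end
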